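(* Let $b \ge a \ge 2$ be integers, and let $G$ be a graph of order $n \ge 2+\sqrt{32a^2+24a+5}$. If $\rho(G) \ge \rho(H_{n,a})$, then $G$ is a fractional $[a,b]$-covered graph unless $G \cong H_{n,a}$.
   Context: All graphs are finite, simple and undirected. $\rho(G)$ denotes the spectral radius (largest eigenvalue of the adjacency matrix) of $G$. For graphs $G_1,G_2$, the join $G_1\nabla G_2$ is obtained from the disjoint union $G_1\cup G_2$ by adding all edges between $G_1$ and $G_2$. For integers $2\le a\le n$, $H_{n,a}:=K_{a-1}\nabla (K_1\cup K_{n-a})$. For positive integers $a\le b$, a fractional $[a,b]$-factor of $G$ with indicator function $h$ is given by a function $h:E(G)\to[0,1]$ with $a\le \sum_{e\in E_G(x)} h(e)\le b$ for every vertex $x$, where $E_G(x)$ is the set of edges incident with $x$ (the factor is the spanning subgraph with edge set $\{e: h(e)>0\}$). $G$ is fractional $[a,b]$-covered if for every edge $e$ of $G$ there is a fractional $[a,b]$-factor with indicator function $h$ such that $h(e)=1$. *)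

theory Defs
  imports Complex_Main "Jordan_Normal_Form.Char_Poly"
begin

section \<open>Finite simple graphs\<close>

record 'v graph =
  verts :: "'v set"
  edges :: "'v set set"

definition simple_graph :: "'v graph \<Rightarrow> bool" where
  "simple_graph G \<longleftrightarrow>
     finite (verts G) \<and> (\<forall>e\<in>edges G. e \<subseteq> verts G \<and> card e = 2)"

definition graph_iso :: "'v graph \<Rightarrow> 'w graph \<Rightarrow> bool" where
  "graph_iso G H \<longleftrightarrow>
     (\<exists>f. bij_betw f (verts G) (verts H) \<and>
        (\<forall>u\<in>verts G. \<forall>v\<in>verts G. {u, v} \<in> edges G \<longleftrightarrow> {f u, f v} \<in> edges H))"

definition complete_graph :: "nat \<Rightarrow> nat graph" where
  "complete_graph n =
     \<lparr> verts = {0..<n}, edges = {{u, v} | u v. u < n \<and> v < n \<and> u \<noteq> v} \<rparr>"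

definition disjoint_union :: "'v graph \<Rightarrow> 'w graph \<Rightarrow> ('v + 'w) graph" where
  "disjoint_union G H =
     \<lparr> verts = verts G <+> verts H,
       edges = image Inl ` edges G \<union> image Inr ` edges H \<rparr>"

definition graph_join :: "'v graph \<Rightarrow> 'w graph \<Rightarrow> ('v + 'w) graph" where
  "graph_join G H =
     \<lparr> verts = verts (disjoint_union G H),
       edges = edges (disjoint_union G H) \<union>
               {{Inl u, Inr v} | u v. u \<in> verts G \<and> v \<in> verts H} \<rparr>"

definition H_graph :: "nat \<Rightarrow> nat \<Rightarrow> (nat + nat + nat) graph" where
  "H_graph n a =
     graph_join (complete_graph (a - 1))
       (disjoint_union (complete_graph 1) (complete_graph (n - a)))"


section \<open>Spectral radius\<close>

text \<open>Library matrices have rows and columns indexed by \<open>{0..<n}\<close>, so the adjacency matrix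
  is taken with respect to an enumeration \<open>vs\<close> of the vertices. The eigenvalues do not depend
  on the enumeration, see \<open>adj_eigenvalue_iff\<close>.\<close>

definition adj_matrix :: "'v graph \<Rightarrow> 'v list \<Rightarrow> real mat" where
  "adj_matrix G vs =
     mat (length vs) (length vs) (\<lambda>(i, j). if {vs ! i, vs ! j} \<in> edges G then 1 else 0)"

definition adj_eigenvalue :: "'v graph \<Rightarrow> real \<Rightarrow> bool" where
  "adj_eigenvalue G l \<longleftrightarrow>
     (\<exists>vs. distinct vs \<and> set vs = verts G \<and> eigenvalue (adj_matrix G vs) l)"

text \<open>The adjacency matrix is real symmetric, so its eigenvalues are all real; the set below is
  finite and, for a graph with at least one vertex, nonempty.\<close>

definition graph_spectral_radius :: "'v graph \<Rightarrow> real" where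
  "graph_spectral_radius G = Max {l. adj_eigenvalue G l}"

lemma adj_matrix_mult_index:
  assumes "distinct vs" "i < length vs" "x \<in> carrier_vec (length vs)"
    and f: "\<And>j. j < length vs \<Longrightarrow> x $ j = f (vs ! j)"
  shows "(adj_matrix G vs *\<^sub>v x) $ i =
           (\<Sum>v\<in>set vs. (if {vs ! i, v} \<in> edges G then 1 else 0) * f v)"
proof -
  have "(adj_matrix G vs *\<^sub>v x) $ i =
      (\<Sum>j = 0..<length vs. (if {vs ! i, vs ! j} \<in> edges G then 1 else 0) * f (vs ! j))"
    using assms by (auto simp: adj_matrix_def scalar_prod_def intro!: sum.cong)
  also have "\<dots> = (\<Sum>v\<in>set vs. (if {vs ! i, v} \<in> edges G then 1 else 0) * f v)"
    by (rule sum.reindex_bij_betw[of "\<lambda>j. vs ! j"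
          "{0..<length vs}" "set vs" "\<lambda>v. (if {vs ! i, v} \<in> edges G then 1 else 0) * f v"])
       (simp add: assms(1) bij_betw_nth lessThan_atLeast0)
  finally show ?thesis .
qed

lemma eigenvalue_adj_matrix_iff:
  assumes vs: "distinct vs"
  shows "eigenvalue (adj_matrix G vs) l \<longleftrightarrow>
    (\<exists>f. (\<exists>v\<in>set vs. f v \<noteq> 0) \<and>
       (\<forall>u\<in>set vs. (\<Sum>v\<in>set vs. (if {u, v} \<in> edges G then 1 else 0) * f v) = l * f u))"
    (is "?L \<longleftrightarrow> ?R")
proof
  assume ?L
  then obtain x where x: "x \<in> carrier_vec (length vs)" "x \<noteq> 0\<^sub>v (length vs)"
      "adj_matrix G vs *\<^sub>v x = l \<cdot>\<^sub>v x"
    by (auto simp: eigenvalue_def eigenvector_def adj_matrix_def)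
  define f where "f v = x $ (THE j. j < length vs \<and> vs ! j = v)" for v
  have f: "x $ j = f (vs ! j)" if "j < length vs" for j
  proof -
    have "(THE k. k < length vs \<and> vs ! k = vs ! j) = j"
      by (rule the_equality) (use that vs nth_eq_iff_index_eq in auto)
    then show ?thesis by (simp add: f_def)
  qed
  from x(1,2) obtain j where "j < length vs" "x $ j \<noteq> 0"
    by (metis carrier_vecD dim_vec eq_vecI index_zero_vec(1) index_zero_vec(2))
  then have 1: "\<exists>v\<in>set vs. f v \<noteq> 0" using f by (metis nth_mem)
  have 2: "(\<Sum>v\<in>set vs. (if {u, v} \<in> edges G then 1 else 0) * f v) = l * f u"
    if u: "u \<in> set vs" for u
  proof -
    from u obtain i where i: "i < length vs" "vs ! i = u" by (auto simp: in_set_conv_nth)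
    show ?thesis
      using adj_matrix_mult_index[OF vs i(1) x(1) f, of G] x(1,3) i f[OF i(1)] by simp
  qed
  show ?R using 1 2 by blast
next
  assume ?R
  then obtain f where f: "\<exists>v\<in>set vs. f v \<noteq> 0"
    "\<And>u. u \<in> set vs \<Longrightarrow>
       (\<Sum>v\<in>set vs. (if {u, v} \<in> edges G then 1 else 0) * f v) = l * f u"
    by blast
  define x where "x = vec (length vs) (\<lambda>j. f (vs ! j))"
  have x: "x \<in> carrier_vec (length vs)" by (simp add: x_def)
  from f(1) obtain j where "j < length vs" "f (vs ! j) \<noteq> 0" by (auto simp: in_set_conv_nth)
  then have "x \<noteq> 0\<^sub>v (length vs)" by (metis index_vec index_zero_vec(1) x_def)
  moreover have "adj_matrix G vs *\<^sub>v x = l \<cdot>\<^sub>v x"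
  proof (rule eq_vecI)
    fix i assume "i < dim_vec (l \<cdot>\<^sub>v x)"
    then have i: "i < length vs" by (simp add: x_def)
    have "(adj_matrix G vs *\<^sub>v x) $ i =
        (\<Sum>v\<in>set vs. (if {vs ! i, v} \<in> edges G then 1 else 0) * f v)"
      by (rule adj_matrix_mult_index[OF vs i x]) (simp add: x_def)
    then show "(adj_matrix G vs *\<^sub>v x) $ i = (l \<cdot>\<^sub>v x) $ i"
      using i f(2)[of "vs ! i"] by (simp add: x_def)
  qed (simp add: x_def adj_matrix_def)
  ultimately show ?L
    using x by (auto simp: eigenvalue_def eigenvector_def adj_matrix_def)
qed

lemma adj_eigenvalue_iff:
  assumes "distinct vs" "set vs = verts G"
  shows "adj_eigenvalue G l \<longleftrightarrow> eigenvalue (adj_matrix G vs) l"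
proof
  assume "adj_eigenvalue G l"
  then obtain ws where ws: "distinct ws" "set ws = set vs" "eigenvalue (adj_matrix G ws) l"
    using assms(2) unfolding adj_eigenvalue_def by blast
  show "eigenvalue (adj_matrix G vs) l"
    using ws(3) unfolding eigenvalue_adj_matrix_iff[OF ws(1)]
      eigenvalue_adj_matrix_iff[OF assms(1)] ws(2) .
next
  assume "eigenvalue (adj_matrix G vs) l"
  then show "adj_eigenvalue G l" using assms unfolding adj_eigenvalue_def by blast
qed


section \<open>Fractional factors\<close>

definition incident_edges :: "'v graph \<Rightarrow> 'v \<Rightarrow> 'v set set" where
  "incident_edges G x = {e \<in> edges G. x \<in> e}"

text \<open>\<open>F\<close> is a fractional \<open>[a, b]\<close>-factor of \<open>G\<close> with indicator function \<open>h\<close>;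
  the values of \<open>h\<close> outside \<open>edges G\<close> are irrelevant.\<close>

definition fractional_factor ::
    "nat \<Rightarrow> nat \<Rightarrow> 'v graph \<Rightarrow> ('v set \<Rightarrow> real) \<Rightarrow> 'v graph \<Rightarrow> bool" where
  "fractional_factor a b G h F \<longleftrightarrow>
     (\<forall>e\<in>edges G. 0 \<le> h e \<and> h e \<le> 1) \<and>
     (\<forall>x\<in>verts G. real a \<le> (\<Sum>e\<in>incident_edges G x. h e) \<and>
                   (\<Sum>e\<in>incident_edges G x. h e) \<le> real b) \<and>
     F = \<lparr> verts = verts G, edges = {e \<in> edges G. h e > 0} \<rparr>"

definition fractional_covered :: "nat \<Rightarrow> nat \<Rightarrow> 'v graph \<Rightarrow> bool" where
  "fractional_covered a b G \<longleftrightarrow>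
     (\<forall>e\<in>edges G. \<exists>h F. fractional_factor a b G h F \<and> h e = 1)"

end

theory Submission
  imports Defs "Jordan_Normal_Form.Spectral_Radius" "HOL-Analysis.Convex"
begin

text \<open>A vertex of degree less than \<open>a\<close> makes \<open>G\<close> a spanning subgraph of \<open>H\<^sub>n\<^sub>,\<^sub>a\<close>; comparing
  with the positive eigenvector of \<open>H\<^sub>n\<^sub>,\<^sub>a\<close>, the spectral assumption then forces
  \<open>G \<cong> H\<^sub>n\<^sub>,\<^sub>a\<close>. Otherwise the minimum degree is at least \<open>a\<close>, and since
  \<open>\<rho>(H\<^sub>n\<^sub>,\<^sub>a) > n - 2\<close>, Hong's bound \<open>\<rho>\<^sup>2 \<le> 2m - n + 1\<close> leaves at most \<open>n - 2\<close> missing edges.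

  For such a dense graph, a set \<open>M\<close> of arcs along edges, with all in- and out-degrees equal to
  \<open>a\<close> and containing both orientations of the given edge, is built by adding one perfect matching
  of the bipartite double cover at a time, using Hall's theorem. Half the number of arcs of
  \<open>M\<close> along an edge is then a fractional factor with all degrees exactly \<open>a\<close>.\<close>

section \<open>Eigenvalues of graphs\<close>

definition neighbours :: "'v graph \<Rightarrow> 'v \<Rightarrow> 'v set" where
  "neighbours G u = {v \<in> verts G. {u, v} \<in> edges G}"

lemma neighbours_sym: "u \<in> verts G \<Longrightarrow> v \<in> neighbours G u \<Longrightarrow> u \<in> neighbours G v"
  by (auto simp: neighbours_def insert_commute)

lemma neighbours_subset: "neighbours G u \<subseteq> verts G"
  by (auto simp: neighbours_def)

lemma neighbours_irrefl: "simple_graph G \<Longrightarrow> u \<notin> neighbours G u"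
  by (auto simp: neighbours_def simple_graph_def)

lemma finite_neighbours: "simple_graph G \<Longrightarrow> finite (neighbours G u)"
  by (auto simp: neighbours_def simple_graph_def)

text \<open>Over the complex numbers an eigenvalue \<open>k\<close> exists. Evaluating the Hermitian
  form \<open>S\<close> at its eigenvector gives \<open>k\<close> times a positive real, and
  symmetry makes \<open>S\<close> its own conjugate, so \<open>k\<close> is real and a root of the
  real characteristic polynomial.\<close>

lemma symmetric_real_eigenvalue_exists:
  fixes A :: "real mat"
  assumes A: "A \<in> carrier_mat n n" and n: "n > 0"
    and sym: "\<And>i j. i < n \<Longrightarrow> j < n \<Longrightarrow> A $$ (i, j) = A $$ (j, i)"
  shows "\<exists>l. eigenvalue A l"
proof -
  define B where "B = map_mat complex_of_real A"
  have B: "B \<in> carrier_mat n n" using A by (simp add: B_def)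
  obtain k where k: "eigenvalue B k"
    using spectrum_non_empty[OF B n] by (auto simp: spectrum_def)
  then obtain v where v: "v \<in> carrier_vec n" "v \<noteq> 0\<^sub>v n" "B *\<^sub>v v = k \<cdot>\<^sub>v v"
    using B by (auto simp: eigenvalue_def eigenvector_def)
  define q where "q = (\<Sum>i<n. (cmod (v $ i))\<^sup>2)"
  define S where "S = (\<Sum>i<n. \<Sum>j<n. cnj (v $ i) * of_real (A $$ (i, j)) * v $ j)"
  from v(1,2) obtain i0 where i0: "i0 < n" "v $ i0 \<noteq> 0"
    by (metis carrier_vecD eq_vecI index_zero_vec(1) index_zero_vec(2))
  have "q > 0" unfolding q_def
    by (rule sum_pos2[of _ i0]) (use i0 in auto)
  have row: "(\<Sum>j<n. of_real (A $$ (i, j)) * v $ j) = k * v $ i" if i: "i < n" for i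
  proof -
    have "(B *\<^sub>v v) $ i = (\<Sum>j<n. of_real (A $$ (i, j)) * v $ j)"
      using i A v(1) by (auto simp: B_def scalar_prod_def lessThan_atLeast0 intro!: sum.cong)
    then show ?thesis using v i by simp
  qed
  have "S = (\<Sum>i<n. cnj (v $ i) * (k * v $ i))"
    unfolding S_def
    by (intro sum.cong refl) (simp add: row[symmetric] sum_distrib_left mult.assoc)
  also have "\<dots> = k * of_real q"
    unfolding q_def of_real_sum sum_distrib_left
    by (intro sum.cong refl) (simp add: complex_norm_square mult_ac del: of_real_power)
  finally have S: "S = k * of_real q" .
  have "cnj S = (\<Sum>i<n. \<Sum>j<n. cnj (v $ j) * of_real (A $$ (j, i)) * v $ i)"
    unfolding S_def cnj_sum by (intro sum.cong refl) (simp add: sym mult_ac)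
  also have "\<dots> = S" unfolding S_def by (rule sum.swap)
  finally have "cnj k = k" using S \<open>q > 0\<close> by auto
  then obtain r where r: "k = of_real r"
    by (metis Reals_cases Reals_cnj_iff)
  have "poly (char_poly B) k = 0"
    using k eigenvalue_root_char_poly[OF B] by simp
  then have "poly (map_poly of_real (char_poly A)) (complex_of_real r) = 0"
    unfolding B_def r of_real_hom.char_poly_hom[OF A] .
  then have "poly (char_poly A) r = 0" by simp
  then show ?thesis using eigenvalue_root_char_poly[OF A] by blast
qed

text \<open>Removes the enumeration of the vertices: an eigenvector becomes a function on vertices
  and a matrix row a sum over neighbours.\<close>

lemma adj_eigenvalue_iff_function:
  assumes "finite (verts G)"
  shows "adj_eigenvalue G l \<longleftrightarrow>
    (\<exists>f. (\<exists>v\<in>verts G. f v \<noteq> 0) \<and> (\<forall>u\<in>verts G. (\<Sum>v\<in>neighbours G u. f v) = l * f u))"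
proof -
  obtain vs where vs: "distinct vs" "set vs = verts G"
    using finite_distinct_list[OF assms] by blast
  have "(\<Sum>v\<in>verts G. (if {u, v} \<in> edges G then 1 else 0) * f v) = (\<Sum>v\<in>neighbours G u. f v)"
    for u and f :: "'a \<Rightarrow> real"
    unfolding neighbours_def using assms
    by (intro sum.mono_neutral_cong_right) auto
  then show ?thesis
    unfolding adj_eigenvalue_iff[OF vs] eigenvalue_adj_matrix_iff[OF vs(1)] vs(2) by simp
qed

lemma finite_adj_eigenvalues:
  assumes "finite (verts G)"
  shows "finite {l. adj_eigenvalue G l}"
proof -
  obtain vs where vs: "distinct vs" "set vs = verts G"
    using finite_distinct_list[OF assms] by blast
  have "adj_matrix G vs \<in> carrier_mat (length vs) (length vs)" by (simp add: adj_matrix_def)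
  from card_finite_spectrum(1)[OF this] show ?thesis
    unfolding spectrum_def adj_eigenvalue_iff[OF vs] by simp
qed

lemma adj_eigenvalue_le_spectral_radius:
  "finite (verts G) \<Longrightarrow> adj_eigenvalue G l \<Longrightarrow> l \<le> graph_spectral_radius G"
  unfolding graph_spectral_radius_def using finite_adj_eigenvalues by (intro Max_ge) auto

lemma adj_eigenvalue_spectral_radius:
  assumes "finite (verts G)" "verts G \<noteq> {}"
  shows "adj_eigenvalue G (graph_spectral_radius G)"
proof -
  obtain vs where vs: "distinct vs" "set vs = verts G"
    using finite_distinct_list[OF assms(1)] by blast
  have "\<exists>l. eigenvalue (adj_matrix G vs) l"
    by (rule symmetric_real_eigenvalue_exists[of _ "length vs"])
       (use vs assms in \<open>auto simp: adj_matrix_def insert_commute\<close>)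
  then have "{l. adj_eigenvalue G l} \<noteq> {}"
    unfolding adj_eigenvalue_iff[OF vs] by simp
  from Max_in[OF finite_adj_eigenvalues[OF assms(1)] this] show ?thesis
    unfolding graph_spectral_radius_def by simp
qed

text \<open>Y. Hong's bound. Squaring the eigenvalue equation at \<open>u\<close> with Cauchy--Schwarz and summing
  over \<open>u\<close> shows that no Perron vector is needed.\<close>

lemma adj_eigenvalue_square_le:
  assumes G: "simple_graph G"
    and no_isolated: "\<And>v. v \<in> verts G \<Longrightarrow> neighbours G v \<noteq> {}"
    and "adj_eigenvalue G l"
  shows "l\<^sup>2 \<le> (\<Sum>v\<in>verts G. real (card (neighbours G v))) - (real (card (verts G)) - 1)"
proof -
  let ?V = "verts G" and ?N = "neighbours G"
  let ?d = "\<lambda>v. real (card (?N v))"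
  have fin: "finite ?V" using G by (simp add: simple_graph_def)
  have finN: "finite (?N u)" for u using G by (rule finite_neighbours)
  obtain f where f: "\<exists>v\<in>?V. f v \<noteq> 0" "\<And>u. u \<in> ?V \<Longrightarrow> (\<Sum>v\<in>?N u. f v) = l * f u"
    using assms(3) unfolding adj_eigenvalue_iff_function[OF fin] by blast
  define F where "F = (\<Sum>v\<in>?V. (f v)\<^sup>2)"
  have "F > 0"
  proof -
    from f(1) obtain v where "v \<in> ?V" "f v \<noteq> 0" by blast
    then show ?thesis unfolding F_def using fin by (intro sum_pos2[of _ v]) auto
  qed
  have row: "l\<^sup>2 * (f u)\<^sup>2 \<le> ?d u * F - (\<Sum>v\<in>?V - ?N u. ?d u * (f v)\<^sup>2)" if u: "u \<in> ?V" for u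
  proof -
    have "l\<^sup>2 * (f u)\<^sup>2 = (\<Sum>v\<in>?N u. f v)\<^sup>2" using f(2)[OF u] by (simp add: power_mult_distrib)
    also have "\<dots> \<le> ?d u * (\<Sum>v\<in>?N u. (f v)\<^sup>2)"
      using sum_squared_le_sum_of_squares[of f "?N u"] by (simp add: mult.commute)
    also have "(\<Sum>v\<in>?N u. (f v)\<^sup>2) = F - (\<Sum>v\<in>?V - ?N u. (f v)\<^sup>2)"
      unfolding F_def using sum.subset_diff[OF neighbours_subset fin, of "\<lambda>v. (f v)\<^sup>2" u] by simp
    finally show ?thesis by (simp add: right_diff_distrib sum_distrib_left)
  qed
  \<comment> \<open>The vertex \<open>v\<close> is its own non-neighbour and contributes its degree;
    each of the remaining \<open>card ?V - 1 - card (?N v)\<close> non-neighbours contributes at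
    least 1, having a neighbour.\<close>
  have non: "real (card ?V) - 1 \<le> (\<Sum>u\<in>?V - ?N v. ?d u)" if v: "v \<in> ?V" for v
  proof -
    have "(\<Sum>u\<in>?V - ?N v. ?d u) = ?d v + (\<Sum>u\<in>?V - ?N v - {v}. ?d u)"
      using fin v neighbours_irrefl[OF G] by (intro sum.remove) auto
    moreover have "(\<Sum>u\<in>?V - ?N v - {v}. ?d u) \<ge> (\<Sum>u\<in>?V - ?N v - {v}. 1)"
      using no_isolated finN by (intro sum_mono) (auto simp: Suc_le_eq card_gt_0_iff)
    moreover have "card (?V - ?N v - {v}) = card ?V - card (?N v) - 1"
      using v fin finN neighbours_irrefl[OF G] neighbours_subset[of G v]
      by (simp add: card_Diff_subset)
    ultimately show ?thesis by simp
  qed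
  have "l\<^sup>2 * F = (\<Sum>u\<in>?V. l\<^sup>2 * (f u)\<^sup>2)" by (simp add: F_def sum_distrib_left)
  also have "\<dots> \<le> (\<Sum>u\<in>?V. ?d u * F - (\<Sum>v\<in>?V - ?N u. ?d u * (f v)\<^sup>2))"
    by (intro sum_mono row)
  also have "\<dots> = (\<Sum>u\<in>?V. ?d u) * F - (\<Sum>u\<in>?V. \<Sum>v\<in>?V - ?N u. ?d u * (f v)\<^sup>2)"
    by (simp add: sum_subtractf sum_distrib_right)
  also have "(\<Sum>u\<in>?V. \<Sum>v\<in>?V - ?N u. ?d u * (f v)\<^sup>2)
      = (\<Sum>u\<in>?V. \<Sum>v | v \<in> ?V \<and> v \<notin> ?N u. ?d u * (f v)\<^sup>2)"
    by (simp add: set_diff_eq)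
  \<comment> \<open>After the swap, the coefficient of \<open>(f v)\<^sup>2\<close> is the degree
    sum over the non-neighbours of \<open>v\<close>, which \<open>non\<close> bounds from
    below.\<close>
  also have "\<dots> = (\<Sum>v\<in>?V. \<Sum>u | u \<in> ?V \<and> v \<notin> ?N u. ?d u * (f v)\<^sup>2)"
    by (rule sum.swap_restrict[OF fin fin])
  also have "\<dots> = (\<Sum>v\<in>?V. (\<Sum>u\<in>?V - ?N v. ?d u) * (f v)\<^sup>2)"
    unfolding sum_distrib_right by (intro sum.cong refl) (auto simp: neighbours_def insert_commute)
  also have "(\<Sum>u\<in>?V. ?d u) * F - \<dots> \<le> (\<Sum>u\<in>?V. ?d u) * F - (real (card ?V) - 1) * F"
    unfolding F_def sum_distrib_left[of "real (card ?V) - 1"]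
    by (intro diff_left_mono sum_mono mult_right_mono non) auto
  finally have "l\<^sup>2 * F \<le> ((\<Sum>u\<in>?V. ?d u) - (real (card ?V) - 1)) * F"
    by (simp add: left_diff_distrib)
  then show ?thesis using \<open>F > 0\<close> by simp
qed

text \<open>If \<open>f\<close> is an eigenvector of \<open>G\<close> for \<open>l\<close>, double counting
  \<open>\<Sum>u v. g u * \<bar>f v\<bar>\<close> over the edges of \<open>G\<close> gives \<open>l \<le> \<theta>\<close>. In the case of equality,
  every vertex in the support of \<open>f\<close> has the same neighbours in \<open>K\<close> and in \<open>G\<close>, and
  the dominating vertex \<open>s\<close> spreads the support to all vertices.\<close>

lemma supergraph_eq_of_eigenvalue_ge:
  fixes g :: "'v \<Rightarrow> real"
  assumes G: "simple_graph G"
    and K: "\<And>u v. u \<in> verts G \<Longrightarrow> v \<in> neighbours G u \<Longrightarrow> K u v"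
    and g: "\<And>u. u \<in> verts G \<Longrightarrow> g u > 0"
      "\<And>u. u \<in> verts G \<Longrightarrow> (\<Sum>v | v \<in> verts G \<and> K u v. g v) = \<theta> * g u"
    and s: "s \<in> verts G" "\<And>v. v \<in> verts G \<Longrightarrow> v \<noteq> s \<Longrightarrow> K v s \<and> K s v"
    and l: "adj_eigenvalue G l" "l \<ge> \<theta>"
    and uv: "u \<in> verts G" "v \<in> verts G" "K u v"
  shows "{u, v} \<in> edges G"
proof -
  let ?V = "verts G" and ?N = "neighbours G"
  have fin: "finite ?V" using G by (simp add: simple_graph_def)
  have finN: "finite (?N u)" for u using G by (rule finite_neighbours)
  obtain f where f: "\<exists>v\<in>?V. f v \<noteq> 0" "\<And>u. u \<in> ?V \<Longrightarrow> (\<Sum>v\<in>?N u. f v) = l * f u"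
    using l(1) unfolding adj_eigenvalue_iff_function[OF fin] by blast
  \<comment> \<open>The deficit at \<open>u\<close>: the total weight of the
    \<open>K\<close>-neighbours of \<open>u\<close> that are missing in \<open>G\<close>.\<close>
  define c where "c u = \<theta> * g u - (\<Sum>v\<in>?N u. g v)" for u
  have cK: "c u = (\<Sum>v\<in>{v \<in> ?V. K u v} - ?N u. g v)" if "u \<in> ?V" for u
  proof -
    have "?N u \<subseteq> {v \<in> ?V. K u v}" using K[OF that] neighbours_subset by fast
    from sum.subset_diff[OF this, of g] fin show ?thesis
      unfolding c_def g(2)[OF that, symmetric] by simp
  qed
  have c0: "c u \<ge> 0" if "u \<in> ?V" for u
    unfolding cK[OF that] using g(1) by (intro sum_nonneg) (auto simp: less_imp_le)
  have edge: "v \<in> ?N u" if "u \<in> ?V" "v \<in> ?V" "K u v" "c u = 0" for u v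
  proof (rule ccontr)
    assume "v \<notin> ?N u"
    then have "c u > 0" unfolding cK[OF that(1)] using that fin g(1)
      by (intro sum_pos2[of _ v]) (auto simp: less_imp_le)
    with that show False by simp
  qed
  let ?a = "\<lambda>u. \<Sum>v\<in>?N u. \<bar>f v\<bar>"
  have row: "l * \<bar>f u\<bar> \<le> ?a u" if "u \<in> ?V" for u
  proof -
    have "l * \<bar>f u\<bar> \<le> \<bar>\<Sum>v\<in>?N u. f v\<bar>"
      unfolding f(2)[OF that] abs_mult by (intro mult_right_mono) auto
    also have "\<dots> \<le> ?a u" by (rule sum_abs)
    finally show ?thesis .
  qed
  have "(\<Sum>u\<in>?V. g u * ?a u) = (\<Sum>u\<in>?V. \<Sum>v | v \<in> ?V \<and> {u, v} \<in> edges G. g u * \<bar>f v\<bar>)"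
    by (simp add: sum_distrib_left neighbours_def)
  also have "\<dots> = (\<Sum>v\<in>?V. \<Sum>u | u \<in> ?V \<and> {u, v} \<in> edges G. g u * \<bar>f v\<bar>)"
    by (rule sum.swap_restrict[OF fin fin])
  also have "\<dots> = (\<Sum>v\<in>?V. \<bar>f v\<bar> * (\<theta> * g v - c v))"
    by (simp add: c_def sum_distrib_left neighbours_def insert_commute mult.commute)
  \<comment> \<open>Two sums of nonnegative terms add up to something nonpositive, so every term
    vanishes: the triangle inequality is tight at every vertex, and the deficit is 0 on the support
    of \<open>f\<close>.\<close>
  finally have "(\<Sum>u\<in>?V. g u * (?a u - l * \<bar>f u\<bar>)) + (\<Sum>u\<in>?V. \<bar>f u\<bar> * c u)
      = (\<Sum>u\<in>?V. (\<theta> - l) * (g u * \<bar>f u\<bar>))"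
    by (simp add: algebra_simps sum.distrib sum_subtractf)
  also have "\<dots> \<le> 0"
    using l(2) g(1) by (intro sum_nonpos mult_nonpos_nonneg) (auto simp: less_imp_le)
  finally have total: "(\<Sum>u\<in>?V. g u * (?a u - l * \<bar>f u\<bar>)) + (\<Sum>u\<in>?V. \<bar>f u\<bar> * c u) \<le> 0" .
  have nn1: "g u * (?a u - l * \<bar>f u\<bar>) \<ge> 0" if "u \<in> ?V" for u
    using that row g(1) by (intro mult_nonneg_nonneg) (auto simp: less_imp_le)
  have nn2: "\<bar>f u\<bar> * c u \<ge> 0" if "u \<in> ?V" for u
    using that c0 by simp
  have sums_nonneg: "(\<Sum>u\<in>?V. g u * (?a u - l * \<bar>f u\<bar>)) \<ge> 0" "(\<Sum>u\<in>?V. \<bar>f u\<bar> * c u) \<ge> 0"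
    by (intro sum_nonneg nn1 nn2; assumption)+
  have "(\<Sum>u\<in>?V. g u * (?a u - l * \<bar>f u\<bar>)) = 0" "(\<Sum>u\<in>?V. \<bar>f u\<bar> * c u) = 0"
    using total sums_nonneg by linarith+
  then have eq: "g u * (?a u - l * \<bar>f u\<bar>) = 0" "\<bar>f u\<bar> * c u = 0" if "u \<in> ?V" for u
    using that nn1 nn2 fin by (auto simp: sum_nonneg_eq_0_iff)
  have spread: "f u \<noteq> 0" if "u \<in> ?V" "v \<in> ?N u" "f v \<noteq> 0" for u v
  proof
    assume "f u = 0"
    then have "?a u = 0" using eq(1)[OF that(1)] g(1)[OF that(1)] by simp
    then show False using that finN by (simp add: sum_nonneg_eq_0_iff)
  qed
  have c_eq: "c u = 0" if "u \<in> ?V" "f u \<noteq> 0" for u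
    using eq(2)[OF that(1)] that(2) by simp
  from f(1) obtain w where w: "w \<in> ?V" "f w \<noteq> 0" by blast
  have "f s \<noteq> 0"
  proof (cases "w = s")
    case False
    then have "s \<in> ?N w" using edge w s c_eq by blast
    then show ?thesis using spread[OF s(1)] neighbours_sym w by metis
  qed (use w in simp)
  have "f u \<noteq> 0"
  proof (cases "u = s")
    case False
    then have "u \<in> ?N s" using edge uv(1) s c_eq \<open>f s \<noteq> 0\<close> by blast
    then show ?thesis using spread[OF uv(1)] neighbours_sym s(1) \<open>f s \<noteq> 0\<close> by metis
  qed (use \<open>f s \<noteq> 0\<close> in simp)
  then have "v \<in> ?N u" using edge uv c_eq by blast
  then show ?thesis by (simp add: neighbours_def)
qed

section \<open>The extremal graph\<close>

text \<open>Adjacency in \<open>K\<^sub>a\<^sub>-\<^sub>1 \<nabla> (K\<^sub>1 \<union> K\<^sub>n\<^sub>-\<^sub>a)\<close>, where \<open>S\<close> is the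
  vertex set of \<open>K\<^sub>a\<^sub>-\<^sub>1\<close> and \<open>w\<close> is the vertex of \<open>K\<^sub>1\<close>.\<close>

definition join_adj :: "'v set \<Rightarrow> 'v \<Rightarrow> 'v \<Rightarrow> 'v \<Rightarrow> bool" where
  "join_adj S w u v \<longleftrightarrow> u \<noteq> v \<and> (u \<in> S \<or> v \<in> S \<or> (u \<noteq> w \<and> v \<noteq> w))"

section \<open>Vertices and edges of the join construction\<close>

lemma verts_H_graph:
  "verts (H_graph n a) = Inl ` {0..<a - 1} \<union> {Inr (Inl 0)} \<union> Inr ` Inr ` {0..<n - a}"
  by (auto simp: H_graph_def graph_join_def disjoint_union_def complete_graph_def Plus_def)

lemma edges_complete_graph_iff:
  "{u, v} \<in> edges (complete_graph n) \<longleftrightarrow> u < n \<and> v < n \<and> u \<noteq> v"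
  by (auto simp: complete_graph_def doubleton_eq_iff)

lemma edges_disjoint_union_iff:
  "{Inl u, Inl v} \<in> edges (disjoint_union G H) \<longleftrightarrow> {u, v} \<in> edges G"
  "{Inr u', Inr v'} \<in> edges (disjoint_union G H) \<longleftrightarrow> {u', v'} \<in> edges H"
  "{Inl u, Inr v'} \<notin> edges (disjoint_union G H)"
  "{Inr u', Inl v} \<notin> edges (disjoint_union G H)"
proof -
  have l: "{Inl u, Inl v} = Inl ` e \<longleftrightarrow> {u, v} = e" for u v :: 'x and e
    using inj_image_eq_iff[OF inj_Inl, of "{u, v}" e] by simp
  have r: "{Inr u, Inr v} = Inr ` e \<longleftrightarrow> {u, v} = e" for u v :: 'x and e
    using inj_image_eq_iff[OF inj_Inr, of "{u, v}" e] by simp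
  have lr: "insert (Inl u) B \<noteq> Inr ` e" "insert (Inr v) B \<noteq> Inl ` e'"
    "{Inr v, Inl u} \<noteq> Inr ` e" "{Inl u, Inr v} \<noteq> Inl ` e'"
    for u :: 'x and v :: 'y and B e e'
    by blast+
  show "{Inl u, Inl v} \<in> edges (disjoint_union G H) \<longleftrightarrow> {u, v} \<in> edges G"
    "{Inr u', Inr v'} \<in> edges (disjoint_union G H) \<longleftrightarrow> {u', v'} \<in> edges H"
    "{Inl u, Inr v'} \<notin> edges (disjoint_union G H)"
    "{Inr u', Inl v} \<notin> edges (disjoint_union G H)"
    unfolding disjoint_union_def by (simp_all add: image_iff l r lr del: image_insert)
qed

lemma edges_graph_join_iff:
  "{Inl u, Inl v} \<in> edges (graph_join G H) \<longleftrightarrow> {u, v} \<in> edges G"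
  "{Inr u', Inr v'} \<in> edges (graph_join G H) \<longleftrightarrow> {u', v'} \<in> edges H"
  "{Inl u, Inr v'} \<in> edges (graph_join G H) \<longleftrightarrow> u \<in> verts G \<and> v' \<in> verts H"
  "{Inr v', Inl u} \<in> edges (graph_join G H) \<longleftrightarrow> u \<in> verts G \<and> v' \<in> verts H"
  by (auto simp: graph_join_def edges_disjoint_union_iff doubleton_eq_iff)

text \<open>Replaces the nested sum-type construction by \<open>join_adj\<close>, which also makes
  sense on the vertex set of \<open>G\<close>.\<close>

lemma edges_H_graph_iff:
  assumes "u \<in> verts (H_graph n a)" "v \<in> verts (H_graph n a)"
  shows "{u, v} \<in> edges (H_graph n a) \<longleftrightarrow> join_adj (Inl ` {0..<a - 1}) (Inr (Inl 0)) u v"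
proof -
  have verts: "i \<in> verts (complete_graph k) \<longleftrightarrow> i < k"
    "Inl x \<in> verts (disjoint_union G H) \<longleftrightarrow> x \<in> verts G"
    "Inr y \<in> verts (disjoint_union G H) \<longleftrightarrow> y \<in> verts H"
    for i k and x :: 'x and y :: 'y and G :: "'x graph" and H :: "'y graph"
    by (auto simp: complete_graph_def disjoint_union_def)
  have S: "Inl i \<in> Inl ` {0..<a - 1} \<longleftrightarrow> i < a - 1" "Inr x \<notin> Inl ` {0..<a - 1}"
    for i :: nat and x :: "nat + nat"
    by auto
  have cases: "(\<exists>i<a - 1. t = Inl i) \<or> t = Inr (Inl 0) \<or> (\<exists>i<n - a. t = Inr (Inr i))"
    if "t \<in> verts (H_graph n a)" for t
    using that unfolding verts_H_graph by auto
  note edges = edges_graph_join_iff edges_disjoint_union_iff edges_complete_graph_iff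
  show ?thesis
    using cases[OF assms(1)] cases[OF assms(2)]
    unfolding H_graph_def join_adj_def
    by (elim disjE exE conjE; simp only: edges verts S; simp)
qed

lemma card_verts_H_graph: "1 \<le> a \<Longrightarrow> a \<le> n \<Longrightarrow> card (verts (H_graph n a)) = n"
proof -
  assume a: "1 \<le> a" "a \<le> n"
  have "verts (H_graph n a)
      = insert (Inr (Inl 0)) (Inl ` {0..<a - 1} \<union> (\<lambda>i. Inr (Inr i)) ` {0..<n - a})"
    by (auto simp: verts_H_graph)
  also have "card \<dots> = Suc (card (Inl ` {0..<a - 1} \<union> (\<lambda>i. Inr (Inr i)) ` {0..<n - a} :: (nat + nat + nat) set))"
    by (intro card_insert_disjoint) auto
  also have "card (Inl ` {0..<a - 1} \<union> (\<lambda>i. Inr (Inr i)) ` {0..<n - a} :: (nat + nat + nat) set)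
      = card (Inl ` {0..<a - 1} :: (nat + nat + nat) set)
        + card ((\<lambda>i. Inr (Inr i)) ` {0..<n - a} :: (nat + nat + nat) set)"
    by (intro card_Un_disjoint) auto
  also have "\<dots> = (a - 1) + (n - a)" by (simp add: card_image inj_on_def)
  finally show ?thesis using a by simp
qed

lemma simple_graph_complete_graph: "simple_graph (complete_graph n)"
  by (auto simp: simple_graph_def complete_graph_def)

lemma simple_graph_disjoint_union:
  fixes G :: "'v graph" and H :: "'w graph"
  assumes "simple_graph G" "simple_graph H"
  shows "simple_graph (disjoint_union G H)"
proof -
  have "card (Inl ` e :: ('v + 'w) set) = card e" "card (Inr ` e' :: ('v + 'w) set) = card e'" for e e'
    by (simp_all add: card_image)
  then show ?thesis
    using assms unfolding simple_graph_def disjoint_union_def by auto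
qed

lemma simple_graph_graph_join:
  assumes "simple_graph G" "simple_graph H"
  shows "simple_graph (graph_join G H)"
proof -
  have "Inl u \<in> verts (disjoint_union G H) \<longleftrightarrow> u \<in> verts G"
    "Inr v \<in> verts (disjoint_union G H) \<longleftrightarrow> v \<in> verts H" for u v
    by (auto simp: disjoint_union_def)
  then show ?thesis
    using simple_graph_disjoint_union[OF assms]
    unfolding simple_graph_def graph_join_def by auto
qed

lemma simple_graph_H_graph: "simple_graph (H_graph n a)"
  unfolding H_graph_def
  by (intro simple_graph_graph_join simple_graph_disjoint_union simple_graph_complete_graph)

text \<open>The eigenvalue equations of \<open>K\<^sub>a\<^sub>-\<^sub>1 \<nabla> (K\<^sub>1 \<union> K\<^sub>n\<^sub>-\<^sub>a)\<close> for a vector that is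
  constant on each of the three parts.\<close>

lemma join_weights_exist:
  fixes a n :: real
  assumes "2 \<le> a" "a + 1 \<le> n"
  obtains \<theta> x y z where "n - 2 < \<theta>" "x > 0" "y > 0" "z > 0"
    "\<theta> * x = (a - 2) * x + y + (n - a) * z" "\<theta> * y = (a - 1) * x"
    "\<theta> * z = (a - 1) * x + (n - a - 1) * z"
proof -
  \<comment> \<open>The characteristic polynomial of the 3 by 3 quotient matrix of the partition
    into \<open>K\<^sub>a\<^sub>-\<^sub>1\<close>, \<open>K\<^sub>1\<close> and
    \<open>K\<^sub>n\<^sub>-\<^sub>a\<close>. It is negative at \<open>n - 2\<close> and nonnegative
    at \<open>n - 1\<close>, so it has a root in between, strictly above
    \<open>n - 2\<close>.\<close>
  define \<phi> where "\<phi> t = t * t * (t - (n - a - 1)) - (a - 2) * (t * (t - (n - a - 1)))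
    - (a - 1) * (t - (n - a - 1)) - (n - a) * ((a - 1) * t)" for t :: real
  have lo: "\<phi> (n - 2) = - ((a - 1) * (a - 1))"
    by (simp add: \<phi>_def algebra_simps)
  have hi: "\<phi> (n - 1) = (n - 1) * n - a * (a - 1)"
    by (simp add: \<phi>_def algebra_simps)
  have "a * (a - 1) \<le> (n - 1) * n"
    using mult_mono[of a n "a - 1" "n - 1"] assms by (simp add: mult.commute)
  then have "0 \<le> \<phi> (n - 1)" unfolding hi by simp
  moreover have "\<phi> (n - 2) \<le> 0" unfolding lo by simp
  moreover have "continuous_on {n - 2..n - 1} \<phi>"
    unfolding \<phi>_def by (intro continuous_intros)
  ultimately have "\<exists>t\<ge>n - 2. t \<le> n - 1 \<and> \<phi> t = 0"
    by (intro IVT') auto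
  then obtain t where t: "n - 2 \<le> t" "\<phi> t = 0" by blast
  have "\<phi> (n - 2) < 0" unfolding lo using assms by simp
  with t have "n - 2 < t" by (cases "t = n - 2") auto
  have pos: "t > 0" "t - (n - a - 1) > 0" using t assms by linarith+
  show thesis
  \<comment> \<open>With these weights the second and third equations are identities in
    \<open>t\<close>, and the first is exactly \<open>\<phi> t = 0\<close>.\<close>
  proof (rule that[of t "t * (t - (n - a - 1))" "(a - 1) * (t - (n - a - 1))" "(a - 1) * t"])
    show "t * (t * (t - (n - a - 1))) = (a - 2) * (t * (t - (n - a - 1)))
        + (a - 1) * (t - (n - a - 1)) + (n - a) * ((a - 1) * t)"
      using t(2) by (simp add: \<phi>_def algebra_simps)
    show "t * (t - (n - a - 1)) > 0" "(a - 1) * (t - (n - a - 1)) > 0" "(a - 1) * t > 0"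
      using pos assms by (auto intro!: mult_pos_pos)
  qed (use \<open>n - 2 < t\<close> in \<open>auto simp: algebra_simps\<close>)
qed

text \<open>The neighbourhood of \<open>u\<close> is \<open>V - {u}\<close>, \<open>S\<close> or
  \<open>V - {u, w}\<close> according to its part, so each row reduces to one of the three scalar
  equations. The vertex set is arbitrary because the weights are used both on
  \<open>H_graph n a\<close> and on the vertices of \<open>G\<close>.\<close>

lemma join_adj_row_sum:
  fixes x y z \<theta> :: real
  assumes V: "finite V" "card V = n" and S: "S \<subseteq> V - {w}" "card S = a - 1" "w \<in> V"
    and a: "1 \<le> a" "a \<le> n"
    and eqs: "\<theta> * x = (real a - 2) * x + y + (real n - real a) * z" "\<theta> * y = (real a - 1) * x"
      "\<theta> * z = (real a - 1) * x + (real n - real a - 1) * z"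
    and g: "g = (\<lambda>v. if v \<in> S then x else if v = w then y else z)"
    and u: "u \<in> V"
  shows "(\<Sum>v | v \<in> V \<and> join_adj S w u v. g v) = \<theta> * g u"
proof -
  have finS: "finite S" and w: "w \<notin> S" using S V finite_subset by auto
  have gw: "g w = y" using w by (simp add: g)
  have sumS: "sum g S = (real a - 1) * x"
    using S a by (simp add: g of_nat_diff)
  have "card (V - insert w S) = n - a"
    using S V a w by (subst card_Diff_subset) (auto simp: finS)
  then have "card (V - S - {w}) = n - a" unfolding Diff_insert[of _ w S] .
  then have "sum g (V - S - {w}) = (real n - real a) * z"
    using a by (simp add: g of_nat_diff)
  moreover have "sum g V = sum g (V - S) + sum g S"
    using S V by (intro sum.subset_diff) auto
  moreover have "sum g (V - S) = g w + sum g (V - S - {w})"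
    using V S w by (intro sum.remove) auto
  ultimately have sumV: "sum g V = (real a - 1) * x + y + (real n - real a) * z"
    using sumS gw by linarith
  have rem: "sum g (V - {u}) = sum g V - g u"
    using sum.remove[OF V(1) u, of g] by simp
  consider "u \<in> S" | "u = w" | "u \<notin> S" "u \<noteq> w" by blast
  then show ?thesis
  proof cases
    case 1
    then have "{v \<in> V. join_adj S w u v} = V - {u}" by (auto simp: join_adj_def)
    then show ?thesis using rem sumV eqs(1) 1 by (simp add: g algebra_simps)
  next
    case 2
    then have "{v \<in> V. join_adj S w u v} = S" using S w by (auto simp: join_adj_def)
    then show ?thesis using sumS eqs(2) 2 w by (simp add: g)
  next
    case 3
    then have "{v \<in> V. join_adj S w u v} = V - {u} - {w}" using S by (auto simp: join_adj_def)
    moreover have "sum g (V - {u}) = g w + sum g (V - {u} - {w})"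
      using V S 3 by (intro sum.remove) auto
    ultimately show ?thesis using rem sumV eqs(3) 3 w by (simp add: g algebra_simps)
  qed
qed

text \<open>Corresponding parts have equal sizes, so bijections between them combine to one of the
  vertex sets; it preserves adjacency because \<open>join_adj\<close> depends only on distinctness
  and on the parts.\<close>

lemma graph_iso_H_graph:
  assumes V: "finite (verts G)" "card (verts G) = n"
    and S: "S \<subseteq> verts G - {w}" "card S = a - 1" "w \<in> verts G" and a: "1 \<le> a" "a \<le> n"
    and edges: "\<And>u v. u \<in> verts G \<Longrightarrow> v \<in> verts G \<Longrightarrow> {u, v} \<in> edges G \<longleftrightarrow> join_adj S w u v"
  shows "graph_iso G (H_graph n a)"
proof -
  let ?S = "Inl ` {0..<a - 1} :: (nat + nat + nat) set" and ?w = "Inr (Inl 0) :: nat + nat + nat"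
    and ?R = "Inr ` Inr ` {0..<n - a} :: (nat + nat + nat) set"
  have finS: "finite S" and w: "w \<notin> S" using S V finite_subset by auto
  have "card (verts G - insert w S) = n - a"
    using S V a w by (subst card_Diff_subset) (auto simp: finS)
  then have "card (verts G - S - {w}) = n - a" unfolding Diff_insert[of _ w S] .
  then have "card (verts G - S - {w}) = card ?R" "card S = card ?S"
    using S(2) by (simp_all add: card_image)
  then obtain f1 f2 where f: "bij_betw f1 S ?S" "bij_betw f2 (verts G - S - {w}) ?R"
    using finite_same_card_bij[of S ?S] finite_same_card_bij[of "verts G - S - {w}" ?R] finS V
    by auto
  define f where "f v = (if v \<in> S then f1 v else if v = w then ?w else f2 v)" for v
  have fS: "bij_betw f S ?S" using f(1) by (rule bij_betw_cong[THEN iffD1, rotated]) (simp add: f_def)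
  have fR: "bij_betw f (verts G - S - {w}) ?R"
    using f(2) by (rule bij_betw_cong[THEN iffD1, rotated]) (simp add: f_def)
  have fw: "bij_betw f {w} {?w}" using w by (simp add: f_def bij_betw_def)
  have "bij_betw f (S \<union> {w} \<union> (verts G - S - {w})) (?S \<union> {?w} \<union> ?R)"
    by (intro bij_betw_combine fS fw fR) auto
  moreover have "S \<union> {w} \<union> (verts G - S - {w}) = verts G" using S by auto
  ultimately have bij: "bij_betw f (verts G) (verts (H_graph n a))"
    unfolding verts_H_graph by simp
  have mem: "(f v \<in> ?S \<longleftrightarrow> v \<in> S) \<and> (f v = ?w \<longleftrightarrow> v = w)" if "v \<in> verts G" for v
  proof -
    consider "v \<in> S" | "v = w" | "v \<in> verts G - S - {w}" using \<open>v \<in> verts G\<close> by blast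
    then show ?thesis
    proof cases
      case 1
      then have "f v \<in> ?S" using fS by (rule bij_betw_apply[rotated])
      then show ?thesis using 1 w by auto
    next
      case 2
      then have "f v = ?w" using w by (simp add: f_def)
      then show ?thesis using 2 w by auto
    next
      case 3
      then have "f v \<in> ?R" using fR by (rule bij_betw_apply[rotated])
      then show ?thesis using 3 by auto
    qed
  qed
  have "{u, v} \<in> edges G \<longleftrightarrow> {f u, f v} \<in> edges (H_graph n a)"
    if uv: "u \<in> verts G" "v \<in> verts G" for u v
  proof -
    have "f u \<in> verts (H_graph n a)" "f v \<in> verts (H_graph n a)"
      using bij uv by (auto intro: bij_betw_apply)
    moreover have "f u = f v \<longleftrightarrow> u = v"
      by (rule inj_on_eq_iff[OF bij_betw_imp_inj_on[OF bij] uv])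
    ultimately show ?thesis
      unfolding edges[OF uv] by (simp only: edges_H_graph_iff join_adj_def mem[OF uv(1)] mem[OF uv(2)])
  qed
  then show ?thesis using bij unfolding graph_iso_def by blast
qed

text \<open>The weights form an eigenvector, so \<theta> is among the eigenvalues whose maximum is
  taken. They stay in the conclusion because the comparison with \<open>G\<close> reuses
  them.\<close>

lemma H_graph_spectral_radius_ge:
  assumes "2 \<le> a" "a < n"
  obtains \<theta> x y z where "real n - 2 < \<theta>" "\<theta> \<le> graph_spectral_radius (H_graph n a)"
    "x > 0" "y > 0" "z > 0"
    "\<theta> * x = (real a - 2) * x + y + (real n - real a) * z" "\<theta> * y = (real a - 1) * x"
    "\<theta> * z = (real a - 1) * x + (real n - real a - 1) * z"
proof -
  let ?H = "H_graph n a"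
  obtain \<theta> x y z where t: "real n - 2 < \<theta>" "x > 0" "y > 0" "z > 0"
    "\<theta> * x = (real a - 2) * x + y + (real n - real a) * z" "\<theta> * y = (real a - 1) * x"
    "\<theta> * z = (real a - 1) * x + (real n - real a - 1) * z"
    by (rule join_weights_exist[of "real a" "real n"]) (use assms in auto)
  let ?S = "Inl ` {0..<a - 1} :: (nat + nat + nat) set" and ?w = "Inr (Inl 0) :: nat + nat + nat"
  define g where "g = (\<lambda>v. if v \<in> ?S then x else if v = ?w then y else z)"
  have fin: "finite (verts ?H)" using simple_graph_H_graph by (auto simp: simple_graph_def)
  have "(\<Sum>v\<in>neighbours ?H u. g v) = \<theta> * g u" if u: "u \<in> verts ?H" for u
  proof -
    have "neighbours ?H u = {v \<in> verts ?H. join_adj ?S ?w u v}"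
      unfolding neighbours_def using edges_H_graph_iff[OF u] by blast
    moreover have "?S \<subseteq> verts ?H - {?w}" "card ?S = a - 1" "?w \<in> verts ?H"
      by (auto simp: verts_H_graph card_image)
    ultimately show ?thesis
      using join_adj_row_sum[OF fin card_verts_H_graph _ _ _ _ _ t(5-7) g_def u] assms by simp
  qed
  moreover have "?w \<in> verts ?H" "g ?w \<noteq> 0" using t by (auto simp: verts_H_graph g_def)
  ultimately have "adj_eigenvalue ?H \<theta>"
    unfolding adj_eigenvalue_iff_function[OF fin] by blast
  from adj_eigenvalue_le_spectral_radius[OF fin this] that t show thesis by blast
qed

lemma graph_iso_H_graph_of_low_degree:
  assumes G: "simple_graph G" "card (verts G) = n" and a: "2 \<le> a" "a < n"
    and rho: "graph_spectral_radius G \<ge> graph_spectral_radius (H_graph n a)"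
    and w: "w \<in> verts G" "card (neighbours G w) < a"
  shows "graph_iso G (H_graph n a)"
proof -
  let ?V = "verts G"
  have fin: "finite ?V" using G by (simp add: simple_graph_def)
  obtain \<theta> x y z where t: "\<theta> \<le> graph_spectral_radius (H_graph n a)" "x > 0" "y > 0" "z > 0"
    "\<theta> * x = (real a - 2) * x + y + (real n - real a) * z" "\<theta> * y = (real a - 1) * x"
    "\<theta> * z = (real a - 1) * x + (real n - real a - 1) * z"
    using H_graph_spectral_radius_ge[OF a] by metis
  have "neighbours G w \<subseteq> ?V - {w}"
    using neighbours_subset neighbours_irrefl[OF G(1)] by fast
  moreover have "card (neighbours G w) \<le> a - 1" "a - 1 \<le> card (?V - {w})"
    using w a G fin by auto
  \<comment> \<open>Enlarging the neighbourhood of \<open>w\<close> to exactly \<open>a - 1\<close>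
    vertices exhibits \<open>G\<close> as a spanning subgraph of the join given by \<open>S\<close>
    and \<open>w\<close>.\<close>
  ultimately obtain S where S: "neighbours G w \<subseteq> S" "S \<subseteq> ?V - {w}" "card S = a - 1"
    using fin by (metis exists_subset_between finite_Diff)
  define g where "g = (\<lambda>v. if v \<in> S then x else if v = w then y else z)"
  \<comment> \<open>Since \<open>a \<ge> 2\<close>, some \<open>s\<close> lies in \<open>S\<close>;
    it is the dominating vertex of the comparison argument.\<close>
  have "S \<noteq> {}" using S a by auto
  then obtain s where s: "s \<in> S" by blast
  have eig: "adj_eigenvalue G (graph_spectral_radius G)"
    using adj_eigenvalue_spectral_radius[OF fin] w by blast
  have sub: "join_adj S w u v" if "u \<in> ?V" "v \<in> neighbours G u" for u v
    using that S neighbours_sym[OF that] neighbours_irrefl[OF G(1)]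
    by (auto simp: join_adj_def)
  have "{u, v} \<in> edges G \<longleftrightarrow> join_adj S w u v" if "u \<in> ?V" "v \<in> ?V" for u v
  proof
    assume "join_adj S w u v"
    show "{u, v} \<in> edges G"
    proof (rule supergraph_eq_of_eigenvalue_ge[of G "join_adj S w" g \<theta> s, OF G(1) sub _ _ _ _ eig])
      show "(\<Sum>v | v \<in> ?V \<and> join_adj S w u v. g v) = \<theta> * g u" if "u \<in> ?V" for u
        using join_adj_row_sum[OF fin G(2) S(2,3) w(1) _ _ t(5-7) g_def that] a by simp
    qed (use t S s that rho \<open>join_adj S w u v\<close> in \<open>auto simp: g_def join_adj_def\<close>)
  qed (use that sub in \<open>auto simp: neighbours_def\<close>)
  then show ?thesis
    using graph_iso_H_graph[OF fin G(2) S(2,3) w(1)] a by simp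
qed

section \<open>Matchings in dense graphs\<close>

text \<open>Either every nonempty proper subset has surplus, and any one element can be matched
  arbitrarily, or the instance splits at a tight subset.\<close>

theorem hall_marriage:
  assumes "finite A" "\<And>a. a \<in> A \<Longrightarrow> finite (R a)"
    and "\<And>X. X \<subseteq> A \<Longrightarrow> card X \<le> card (\<Union>a\<in>X. R a)"
  shows "\<exists>f. inj_on f A \<and> (\<forall>a\<in>A. f a \<in> R a)"
  using assms
proof (induction "card A" arbitrary: A R rule: less_induct)
  case less
  note fin = less.prems(1) and finR = less.prems(2) and hall = less.prems(3)
  show ?case
  proof (cases "A = {}")
    case False
    then obtain a0 where a0: "a0 \<in> A" by blast
    show ?thesis
    proof (cases "\<exists>X. X \<subset> A \<and> X \<noteq> {} \<and> card X = card (\<Union>a\<in>X. R a)")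
      case True
      then obtain X where X: "X \<subset> A" "X \<noteq> {}" "card X = card (\<Union>a\<in>X. R a)" by blast
      let ?U = "\<Union>a\<in>X. R a"
      have finX: "finite X" using X fin finite_subset by blast
      have finU: "finite ?U" using X finX finR by blast
      have "\<exists>f. inj_on f X \<and> (\<forall>a\<in>X. f a \<in> R a)"
        by (rule less.hyps) (use X(1) psubset_card_mono[OF fin X(1)] finX finR hall in auto)
      then obtain f where f: "inj_on f X" "\<And>a. a \<in> X \<Longrightarrow> f a \<in> R a" by blast
      \<comment> \<open>Hall's condition survives the removal of \<open>?U\<close>: apply it to
        \<open>X \<union> Y\<close> and cancel \<open>card X = card ?U\<close>.\<close>
      have "\<exists>g. inj_on g (A - X) \<and> (\<forall>a\<in>A - X. g a \<in> R a - ?U)"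
      proof (rule less.hyps)
        have "X \<noteq> {} \<and> X \<subseteq> A" using X by blast
        then show "card (A - X) < card A"
          using fin by (intro psubset_card_mono) auto
        fix Y assume Y: "Y \<subseteq> A - X"
        have finY: "finite Y" using Y fin finite_subset by blast
        have "card X + card Y = card (X \<union> Y)"
          using Y finX finY by (intro card_Un_disjoint[symmetric]) auto
        also have "\<dots> \<le> card (\<Union>a\<in>X \<union> Y. R a)" using Y X by (intro hall) auto
        also have "(\<Union>a\<in>X \<union> Y. R a) = ?U \<union> (\<Union>a\<in>Y. R a - ?U)" by auto
        also have "card \<dots> \<le> card ?U + card (\<Union>a\<in>Y. R a - ?U)" by (rule card_Un_le)
        finally show "card Y \<le> card (\<Union>a\<in>Y. R a - ?U)" using X(3) by simp
      qed (use fin finR in auto)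
      then obtain g where g: "inj_on g (A - X)" "\<And>a. a \<in> A - X \<Longrightarrow> g a \<in> R a - ?U" by blast
      have "g u \<noteq> f v" if "u \<in> A - X" "v \<in> X" for u v
        using g(2)[OF that(1)] f(2)[OF that(2)] that(2) by auto
      then have "inj_on (\<lambda>a. if a \<in> X then f a else g a) A"
        using f(1) g(1) by (intro inj_onI) (auto split: if_splits dest: inj_onD, metis+)
      moreover have "(if a \<in> X then f a else g a) \<in> R a" if "a \<in> A" for a
        using f g that by auto
      ultimately show ?thesis by (intro exI[of _ "\<lambda>a. if a \<in> X then f a else g a"]) blast
    next
      case nontight: False
      have "R a0 \<noteq> {}" using hall[of "{a0}"] a0 by auto
      then obtain b where b: "b \<in> R a0" by blast
      \<comment> \<open>The surplus of at least one on nonempty proper subsets absorbs the loss of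
        \<open>b\<close>.\<close>
      have "\<exists>g. inj_on g (A - {a0}) \<and> (\<forall>a\<in>A - {a0}. g a \<in> R a - {b})"
      proof (rule less.hyps)
        show "card (A - {a0}) < card A" using a0 fin by (intro psubset_card_mono) auto
        fix Y assume Y: "Y \<subseteq> A - {a0}"
        show "card Y \<le> card (\<Union>a\<in>Y. R a - {b})"
        proof (cases "Y = {}")
          case False
          have "Y \<subset> A" using Y a0 by blast
          then have "card Y < card (\<Union>a\<in>Y. R a)"
            using nontight False hall[of Y] by (metis le_neq_implies_less psubset_imp_subset)
          moreover have "(\<Union>a\<in>Y. R a - {b}) = (\<Union>a\<in>Y. R a) - {b}" by auto
          moreover have "card ((\<Union>a\<in>Y. R a) - {b}) \<ge> card (\<Union>a\<in>Y. R a) - 1"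
            by (metis card_Diff_singleton diff_le_self le_refl Diff_empty Diff_insert0)
          ultimately show ?thesis by simp
        qed simp
      qed (use fin finR in auto)
      then obtain g where g: "inj_on g (A - {a0})" "\<And>a. a \<in> A - {a0} \<Longrightarrow> g a \<in> R a - {b}" by blast
      have "inj_on (g(a0 := b)) A"
        using g by (intro inj_onI) (auto split: if_splits dest: inj_onD)
      moreover have "(g(a0 := b)) a \<in> R a" if "a \<in> A" for a
        using g b that by auto
      ultimately show ?thesis by (intro exI[of _ "g(a0 := b)"]) blast
    qed
  qed simp
qed

text \<open>A \<open>k\<close>-regular subgraph of the bipartite double cover of \<open>V\<close>.
  The two orientations of an edge count separately, so the case \<open>k = 1\<close> is the graph of
  a permutation and an odd number of vertices is no obstruction.\<close>

definition regular_arcs :: "'v set \<Rightarrow> nat \<Rightarrow> ('v \<times> 'v) set \<Rightarrow> bool" where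
  "regular_arcs V k M \<longleftrightarrow> M \<subseteq> V \<times> V \<and>
     (\<forall>u\<in>V. card {v. (u, v) \<in> M} = k \<and> card {v. (v, u) \<in> M} = k)"

text \<open>Each nonadjacent pair occurs in both orientations, so the cardinality is twice the number
  of missing edges.\<close>

definition nonadj_pairs :: "'v graph \<Rightarrow> 'v set \<Rightarrow> ('v \<times> 'v) set" where
  "nonadj_pairs G V = {(u, v). u \<in> V \<and> v \<in> V \<and> u \<noteq> v \<and> {u, v} \<notin> edges G}"

lemma regular_arcs_converse: "regular_arcs V k M \<Longrightarrow> regular_arcs V k (M\<inverse>)"
  by (auto simp: regular_arcs_def)

text \<open>A pair whose reverse also lies in \<open>X \<times> Y\<close> has both ends in \<open>X\<close>.\<close>

lemma card_nonadj_pairs_ge: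
  assumes "finite V" "X \<subseteq> V" "Y \<subseteq> V"
  shows "2 * card (nonadj_pairs G V \<inter> X \<times> Y) \<le> card (nonadj_pairs G V) + card X * (card X - 1)"
proof -
  let ?C = "nonadj_pairs G V" and ?S = "nonadj_pairs G V \<inter> X \<times> Y"
  have fX: "finite X" by (rule finite_subset[OF assms(2,1)])
  have "?C \<subseteq> V \<times> V" by (auto simp: nonadj_pairs_def)
  then have fC: "finite ?C" using assms finite_subset by blast
  have "?S \<inter> ?S\<inverse> \<subseteq> Sigma X (\<lambda>x. X - {x})"
    by (auto simp: nonadj_pairs_def)
  then have "card (?S \<inter> ?S\<inverse>) \<le> card (Sigma X (\<lambda>x. X - {x}))"
    using fX by (intro card_mono) auto
  also have "\<dots> = card X * (card X - 1)" using fX by simp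
  finally have i: "card (?S \<inter> ?S\<inverse>) \<le> card X * (card X - 1)" .
  have "?S \<union> ?S\<inverse> \<subseteq> ?C" by (auto simp: nonadj_pairs_def insert_commute)
  then have u: "card (?S \<union> ?S\<inverse>) \<le> card ?C" by (intro card_mono fC)
  have "card ?S + card (?S\<inverse>) = card (?S \<union> ?S\<inverse>) + card (?S \<inter> ?S\<inverse>)"
    using fC by (intro card_Un_Int) auto
  then show ?thesis using i u by (simp add: card_inverse)
qed

text \<open>Every pair in \<open>X \<times> Y\<close> is a loop, an arc of \<open>M\<close>, or nonadjacent.\<close>

lemma unavailable_rectangle_bound:
  assumes "finite V" "X \<subseteq> V" "Y \<subseteq> V" and M: "regular_arcs V k M"
    and sub: "\<And>u v. u \<in> X \<Longrightarrow> v \<in> Y \<Longrightarrow> {u, v} \<in> edges G \<Longrightarrow> (u, v) \<in> M"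
  shows "2 * (card X * card Y) \<le> 2 * (card X * (k + 1))
    + card (nonadj_pairs G V) + card X * (card X - 1)"
proof -
  let ?S = "nonadj_pairs G V \<inter> X \<times> Y" and ?D = "Sigma X (\<lambda>u. insert u {v. (u, v) \<in> M})"
  have fX: "finite X" by (rule finite_subset[OF assms(2,1)])
  have MV: "M \<subseteq> V \<times> V" using M by (simp add: regular_arcs_def)
  have fM: "finite {v. (u, v) \<in> M}" for u
    by (rule finite_subset[OF _ assms(1)]) (use MV in auto)
  have "X \<times> Y \<subseteq> ?S \<union> ?D"
    using sub assms by (auto simp: nonadj_pairs_def)
  moreover have "finite (?S \<union> ?D)"
    using fX fM finite_subset[OF assms(3,1)] by auto
  ultimately have "card (X \<times> Y) \<le> card (?S \<union> ?D)" by (intro card_mono)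
  also have "\<dots> \<le> card ?S + card ?D" by (rule card_Un_le)
  also have "card ?D = (\<Sum>u\<in>X. card (insert u {v. (u, v) \<in> M}))"
    using fX fM by (intro card_SigmaI) auto
  also have "\<dots> \<le> (\<Sum>u\<in>X. k + 1)"
    using M assms(2) fM by (intro sum_mono) (auto simp: regular_arcs_def card_insert_if subset_iff)
  finally have "card X * card Y \<le> card ?S + card X * (k + 1)"
    by (simp add: card_cartesian_product)
  then show ?thesis using card_nonadj_pairs_ge[OF assms(1-3), of G] by linarith
qed

text \<open>Contradicts \<open>unavailable_rectangle_bound\<close> for a rectangle with shorter side
  \<open>p\<close>. The integers avoid truncated subtraction.\<close>

lemma rectangle_inequality:
  fixes p q k N \<mu> :: nat
  assumes "2 \<le> p" "p \<le> q" "p + q = N + 1" "4 * k + 9 \<le> N" "\<mu> \<le> 2 * N"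
  shows "2 * (p * (k + 1)) + \<mu> + p * (p - 1) < 2 * (p * q)"
proof -
  define P Q K where "P = int p" "Q = int q" "K = int k"
  note defs = this
  \<comment> \<open>Once the bounds on \<open>K\<close> and \<open>\<mu>\<close> are inserted, the
    right-hand side exceeds the left-hand side by at least half this product plus 2.\<close>
  have "0 \<le> (3 * P - 4) * (Q - P)" using assms defs by (intro mult_nonneg_nonneg) auto
  moreover have "P * (4 * K) \<le> P * (P + Q - 10)" using assms defs by (intro mult_left_mono) auto
  moreover have "int N = P + Q - 1" "int \<mu> \<le> 2 * int N" using assms(3,5) defs by linarith+
  ultimately have "2 * (P * (K + 1)) + int \<mu> + P * (P - 1) < 2 * (P * Q)"
    by (simp add: algebra_simps)
  moreover have "int (p * (p - 1)) = P * (P - 1)"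
    using assms(1) defs(1) by (simp only: of_nat_mult of_nat_diff) simp
  moreover have "int (2 * (p * (k + 1))) = 2 * (P * (K + 1))" "int (2 * (p * q)) = 2 * (P * Q)"
    by (simp_all add: defs algebra_simps)
  ultimately have "int (2 * (p * (k + 1)) + \<mu> + p * (p - 1)) < int (2 * (p * q))"
    by linarith
  then show ?thesis by (simp only: of_nat_less_iff)
qed

text \<open>A violation of Hall's condition is a set \<open>X\<close> such that no available arc leads from
  \<open>X\<close> to a set \<open>Y\<close> with \<open>card X + card Y = card V + 1\<close>. The degree conditions make both
  sets have at least two elements, and such a rectangle has too many unavailable pairs.\<close>

lemma exists_matching:
  assumes V: "finite V" "4 * k + 9 \<le> card V"
    and C: "card (nonadj_pairs G V) \<le> 2 * card V" and M: "regular_arcs V k M"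
    and deg: "\<And>u. u \<in> V \<Longrightarrow> \<exists>v\<in>V. {u, v} \<in> edges G \<and> (u, v) \<notin> M"
      "\<And>u. u \<in> V \<Longrightarrow> \<exists>v\<in>V. {v, u} \<in> edges G \<and> (v, u) \<notin> M"
  shows "\<exists>M'. regular_arcs V 1 M' \<and> M' \<inter> M = {} \<and> (\<forall>(u, v)\<in>M'. {u, v} \<in> edges G)"
proof -
  define R where "R u = {v \<in> V. {u, v} \<in> edges G \<and> (u, v) \<notin> M}" for u
  have hall: "card X \<le> card (\<Union>u\<in>X. R u)" if X: "X \<subseteq> V" for X
  proof (rule ccontr)
    assume less: "\<not> card X \<le> card (\<Union>u\<in>X. R u)"
    define U where "U = (\<Union>u\<in>X. R u)"
    have UV: "U \<subseteq> V" by (auto simp: U_def R_def)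
    have finX: "finite X" and finU: "finite U" using X UV V finite_subset by auto
    obtain u where "u \<in> X" using less by fastforce
    then have "R u \<noteq> {}" using deg(1)[of u] X by (auto simp: R_def)
    with \<open>u \<in> X\<close> have "U \<noteq> {}" by (auto simp: U_def)
    then have "card U \<ge> 1" using finU by (simp add: Suc_le_eq card_gt_0_iff)
    then have pX: "2 \<le> card X" using less by (simp add: U_def)
    have "card U < card V" using less card_mono[OF V(1) X] by (simp add: U_def)
    \<comment> \<open>An available arc into \<open>w \<notin> U\<close> must start outside
      \<open>X\<close>; hence \<open>X\<close> is not all of \<open>V\<close>, and \<open>Y\<close>
      below has at least two elements.\<close>
    then obtain w where w: "w \<in> V" "w \<notin> U" using UV by (metis less_irrefl subsetI subset_antisym)
    obtain v where v: "v \<in> V" "w \<in> R v" using deg(2)[OF w(1)] w by (auto simp: R_def)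
    then have "v \<notin> X" using w by (auto simp: U_def)
    then have "card X < card V" using X v V by (intro psubset_card_mono) auto
    moreover have "card (V - U) = card V - card U" using finU UV by (rule card_Diff_subset)
    ultimately have "card V + 1 - card X \<le> card (V - U)"
      using less card_mono[OF V(1) UV] by (simp add: U_def)
    then obtain Y where Y: "Y \<subseteq> V - U" "card Y = card V + 1 - card X"
      by (metis obtain_subset_with_card_n)
    have pY: "2 \<le> card Y" "card X + card Y = card V + 1" using Y \<open>card X < card V\<close> by auto
    have avail: "(u, v) \<in> M" if "u \<in> X" "v \<in> Y" "{u, v} \<in> edges G" for u v
      using that X Y by (auto simp: U_def R_def)
    show False
    proof (cases "card X \<le> card Y")
      case True
      have "2 * (card X * card Y) \<le> 2 * (card X * (k + 1))
          + card (nonadj_pairs G V) + card X * (card X - 1)"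
        using X Y by (intro unavailable_rectangle_bound[OF V(1) _ _ M] avail) auto
      moreover have "2 * (card X * (k + 1)) + card (nonadj_pairs G V) + card X * (card X - 1)
          < 2 * (card X * card Y)"
        by (rule rectangle_inequality[where N = "card V"]) (use True pX pY V C in auto)
      ultimately show False by linarith
    next
      case False
      have "2 * (card Y * card X) \<le> 2 * (card Y * (k + 1))
          + card (nonadj_pairs G V) + card Y * (card Y - 1)"
      proof (rule unavailable_rectangle_bound[OF V(1) _ X regular_arcs_converse[OF M]])
        show "Y \<subseteq> V" using Y by blast
        show "(u, v) \<in> M\<inverse>" if "u \<in> Y" "v \<in> X" "{u, v} \<in> edges G" for u v
          using avail[of v u] that by (simp add: insert_commute)
      qed
      moreover have "2 * (card Y * (k + 1)) + card (nonadj_pairs G V) + card Y * (card Y - 1)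
          < 2 * (card Y * card X)"
        by (rule rectangle_inequality[where N = "card V"]) (use False pX pY V C in auto)
      ultimately show False by linarith
    qed
  qed
  have "\<exists>f. inj_on f V \<and> (\<forall>u\<in>V. f u \<in> R u)"
    by (intro hall_marriage V(1) hall) (simp_all add: R_def V(1))
  then obtain f where f: "inj_on f V" "\<And>u. u \<in> V \<Longrightarrow> f u \<in> R u" by blast
  \<comment> \<open>An injective self-map of a finite set is onto, which gives in-degree 1 as well
    as out-degree 1.\<close>
  have "f ` V = V"
    using f V by (intro card_subset_eq) (auto simp: card_image R_def)
  define M' where "M' = (\<lambda>u. (u, f u)) ` V"
  have "card {v. (v, u) \<in> M'} = 1" "card {v. (u, v) \<in> M'} = 1" if u: "u \<in> V" for u
  proof -
    have "{v. (u, v) \<in> M'} = {f u}" using u by (auto simp: M'_def)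
    then show "card {v. (u, v) \<in> M'} = 1" by simp
    have "u \<in> f ` V" using u \<open>f ` V = V\<close> by simp
    then obtain w where "w \<in> V" "f w = u" by blast
    then have "{v. (v, u) \<in> M'} = {w}" using f(1) by (auto simp: M'_def dest: inj_onD)
    then show "card {v. (v, u) \<in> M'} = 1" by simp
  qed
  then have "regular_arcs V 1 M'"
    using f by (auto simp: regular_arcs_def M'_def R_def)
  moreover have "M' \<inter> M = {} \<and> (\<forall>(u, v)\<in>M'. {u, v} \<in> edges G)"
    using f by (auto simp: M'_def R_def)
  ultimately show ?thesis by blast
qed

lemma regular_arcs_Un:
  assumes "finite V" "regular_arcs V k M" "regular_arcs V l M'" "M' \<inter> M = {}"
  shows "regular_arcs V (k + l) (M \<union> M')"
proof -
  have sub: "M \<subseteq> V \<times> V" "M' \<subseteq> V \<times> V" using assms by (auto simp: regular_arcs_def)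
  have fin: "finite {v. (u, v) \<in> M}" "finite {v. (u, v) \<in> M'}"
    "finite {v. (v, u) \<in> M}" "finite {v. (v, u) \<in> M'}" for u
    by (rule finite_subset[OF _ assms(1)]; use sub in auto)+
  have "card {v. (u, v) \<in> M \<union> M'} = card {v. (u, v) \<in> M} + card {v. (u, v) \<in> M'}" for u
    using assms(4) fin by (subst card_Un_disjoint[symmetric]) (auto intro!: arg_cong[of _ _ card])
  moreover have "card {v. (v, u) \<in> M \<union> M'} = card {v. (v, u) \<in> M} + card {v. (v, u) \<in> M'}" for u
    using assms(4) fin by (subst card_Un_disjoint[symmetric]) (auto intro!: arg_cong[of _ _ card])
  ultimately show ?thesis using assms sub by (auto simp: regular_arcs_def)
qed

lemma extend_regular_arcs:
  assumes V: "finite V" "4 * a + 5 \<le> card V" "card (nonadj_pairs G V) \<le> 2 * card V"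
    and deg: "\<And>u. u \<in> V \<Longrightarrow> a \<le> card {v \<in> V. {u, v} \<in> edges G}"
    and M: "regular_arcs V k M" "\<And>u v. (u, v) \<in> M \<Longrightarrow> {u, v} \<in> edges G" and "k \<le> a"
  shows "\<exists>M'. regular_arcs V a M' \<and> M \<subseteq> M' \<and> (\<forall>(u, v)\<in>M'. {u, v} \<in> edges G)"
  using \<open>k \<le> a\<close> M
proof (induction "a - k" arbitrary: k M)
  case 0
  then show ?case by (intro exI[of _ M]) auto
next
  case (Suc d)
  then have k: "k < a" by simp
  have MV: "M \<subseteq> V \<times> V" using Suc.prems by (simp add: regular_arcs_def)
  have *: "\<exists>v\<in>V. {u, v} \<in> edges G \<and> v \<notin> B" if "u \<in> V" "card B = k" "B \<subseteq> V" for u B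
  proof (rule ccontr)
    assume "\<not> ?thesis"
    then have "card {v \<in> V. {u, v} \<in> edges G} \<le> card B"
      using finite_subset[OF that(3) V(1)] by (intro card_mono) auto
    with deg[OF that(1)] that k show False by simp
  qed
  have "\<exists>M'. regular_arcs V 1 M' \<and> M' \<inter> M = {} \<and> (\<forall>(u, v)\<in>M'. {u, v} \<in> edges G)"
  proof (rule exists_matching[OF V(1) _ V(3) Suc.prems(2)])
    fix u assume u: "u \<in> V"
    have "card {v. (u, v) \<in> M} = k" "card {v. (v, u) \<in> M} = k"
      using Suc.prems(2) u by (simp_all add: regular_arcs_def)
    moreover have "{v. (u, v) \<in> M} \<subseteq> V" "{v. (v, u) \<in> M} \<subseteq> V" using MV by auto
    ultimately have "\<exists>v\<in>V. {u, v} \<in> edges G \<and> v \<notin> {v. (u, v) \<in> M}"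
      "\<exists>v\<in>V. {u, v} \<in> edges G \<and> v \<notin> {v. (v, u) \<in> M}"
      using * u by blast+
    then show "\<exists>v\<in>V. {u, v} \<in> edges G \<and> (u, v) \<notin> M" "\<exists>v\<in>V. {v, u} \<in> edges G \<and> (v, u) \<notin> M"
      by (simp_all add: insert_commute)
  qed (use V k in simp)
  then obtain M' where M': "regular_arcs V 1 M'" "M' \<inter> M = {}"
    "\<forall>(u, v)\<in>M'. {u, v} \<in> edges G" by blast
  have "\<exists>M''. regular_arcs V a M'' \<and> M \<union> M' \<subseteq> M'' \<and> (\<forall>(u, v)\<in>M''. {u, v} \<in> edges G)"
  proof (rule Suc.hyps(1)[of "k + 1"])
    show "regular_arcs V (k + 1) (M \<union> M')"
      using V(1) Suc.prems(2) M'(1,2) by (rule regular_arcs_Un)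
  qed (use Suc M' k in auto)
  then show ?case by blast
qed

section \<open>Fractional factors from regular arc sets\<close>

lemma fractional_factor_of_regular_arcs:
  assumes G: "simple_graph G" and "a \<le> b" and M: "regular_arcs (verts G) a M"
    and adj: "\<And>u v. (u, v) \<in> M \<Longrightarrow> {u, v} \<in> edges G"
    and xy: "x \<noteq> y" "(x, y) \<in> M" "(y, x) \<in> M"
  shows "\<exists>h F. fractional_factor a b G h F \<and> h {x, y} = 1"
proof -
  define h :: "'a set \<Rightarrow> real" where "h e = real (card {p \<in> M. {fst p, snd p} = e}) / 2" for e
  have h: "h {u, v} = (of_bool ((u, v) \<in> M) + of_bool ((v, u) \<in> M)) / 2" if "u \<noteq> v" for u v
  proof -
    have "{p \<in> M. {fst p, snd p} = {u, v}}
        = (if (u, v) \<in> M then {(u, v)} else {}) \<union> (if (v, u) \<in> M then {(v, u)} else {})"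
      by (auto simp: doubleton_eq_iff)
    then show ?thesis using that by (simp add: h_def)
  qed
  have bounds: "0 \<le> h e \<and> h e \<le> 1" if e: "e \<in> edges G" for e
  proof -
    obtain u v where "e = {u, v}" "u \<noteq> v"
      using G e by (auto simp: simple_graph_def card_2_iff)
    then show ?thesis by (simp add: h)
  qed
  have degree: "(\<Sum>e\<in>incident_edges G u. h e) = real a" if u: "u \<in> verts G" for u
  proof -
    let ?N = "neighbours G u"
    have N: "v \<in> ?N \<longleftrightarrow> {u, v} \<in> edges G" for v
      using G by (auto simp: neighbours_def simple_graph_def)
    have irr: "v \<noteq> u" if "v \<in> ?N" for v
      using that neighbours_irrefl[OF G] by blast
    \<comment> \<open>Indexing the edges at \<open>u\<close> by their other ends turns the sum of
      \<open>h\<close> into half of out-degree plus in-degree.\<close>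
    have "incident_edges G u = (\<lambda>v. {u, v}) ` ?N"
    proof (intro equalityI subsetI)
      fix e assume "e \<in> incident_edges G u"
      then have e: "e \<in> edges G" "u \<in> e" by (auto simp: incident_edges_def)
      then have "card e = 2" using G by (simp add: simple_graph_def)
      then obtain v where "e = {u, v}" using e(2) by (auto simp: card_2_iff)
      then show "e \<in> (\<lambda>v. {u, v}) ` ?N" using e N by blast
    qed (auto simp: incident_edges_def N)
    moreover have "inj_on (\<lambda>v. {u, v}) ?N"
      by (intro inj_onI) (auto simp: doubleton_eq_iff)
    ultimately have "(\<Sum>e\<in>incident_edges G u. h e) = (\<Sum>v\<in>?N. h {u, v})"
      by (simp add: sum.reindex)
    also have "\<dots> = (\<Sum>v\<in>?N. (of_bool ((u, v) \<in> M) + of_bool ((v, u) \<in> M)) / 2)"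
      using irr by (intro sum.cong refl h) blast
    also have "\<dots> = ((\<Sum>v\<in>?N. of_bool ((u, v) \<in> M)) + (\<Sum>v\<in>?N. of_bool ((v, u) \<in> M))) / 2"
      by (simp add: sum.distrib flip: sum_divide_distrib)
    also have "(\<Sum>v\<in>?N. of_bool ((u, v) \<in> M)) = real (card {v. (u, v) \<in> M})"
    proof -
      have "?N \<inter> {v. (u, v) \<in> M} = {v. (u, v) \<in> M}" using adj N by auto
      then show ?thesis using finite_neighbours[OF G] by (simp add: sum_of_bool_eq)
    qed
    also have "(\<Sum>v\<in>?N. of_bool ((v, u) \<in> M)) = real (card {v. (v, u) \<in> M})"
    proof -
      have "?N \<inter> {v. (v, u) \<in> M} = {v. (v, u) \<in> M}" using adj N by (auto simp: insert_commute)
      then show ?thesis using finite_neighbours[OF G] by (simp add: sum_of_bool_eq)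
    qed
    finally show ?thesis using M u by (simp add: regular_arcs_def)
  qed
  have "fractional_factor a b G h \<lparr>verts = verts G, edges = {e \<in> edges G. h e > 0}\<rparr>"
    using bounds degree \<open>a \<le> b\<close> by (simp add: fractional_factor_def)
  moreover have "h {x, y} = 1" using h[OF xy(1)] xy by simp
  ultimately show ?thesis by blast
qed

section \<open>Regular arc sets through a prescribed edge\<close>

lemma regular_arcs_Un_disjoint:
  assumes "regular_arcs A k M" "regular_arcs B k M'" "A \<inter> B = {}"
  shows "regular_arcs (A \<union> B) k (M \<union> M')"
proof -
  have sub: "M \<subseteq> A \<times> A" "M' \<subseteq> B \<times> B" using assms by (auto simp: regular_arcs_def)
  have "{v. (u, v) \<in> M \<union> M'} = {v. (u, v) \<in> M}" "{v. (v, u) \<in> M \<union> M'} = {v. (v, u) \<in> M}"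
    if "u \<in> A" for u using that sub assms(3) by auto
  moreover have "{v. (u, v) \<in> M \<union> M'} = {v. (u, v) \<in> M'}" "{v. (v, u) \<in> M \<union> M'} = {v. (v, u) \<in> M'}"
    if "u \<in> B" for u using that sub assms(3) by auto
  moreover have "M \<union> M' \<subseteq> (A \<union> B) \<times> (A \<union> B)" using sub by blast
  ultimately show ?thesis
    using assms(1,2) unfolding regular_arcs_def by (simp add: ball_Un)
qed

lemma regular_arcs_edge:
  assumes "x \<noteq> y"
  shows "regular_arcs {x, y} 1 {(x, y), (y, x)}"
proof -
  have "{v. (x, v) \<in> {(x, y), (y, x)}} = {y}" "{v. (v, x) \<in> {(x, y), (y, x)}} = {y}"
    "{v. (y, v) \<in> {(x, y), (y, x)}} = {x}" "{v. (v, y) \<in> {(x, y), (y, x)}} = {x}"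
    using assms by auto
  then show ?thesis by (simp add: regular_arcs_def)
qed

lemma regular_arcs_triangle:
  assumes "x \<noteq> y" "x \<noteq> z" "y \<noteq> z"
  shows "regular_arcs {x, y, z} 2 {(x, y), (y, x), (x, z), (z, x), (y, z), (z, y)}"
proof -
  let ?T = "{(x, y), (y, x), (x, z), (z, x), (y, z), (z, y)}"
  have "{v. (x, v) \<in> ?T} = {y, z}" "{v. (v, x) \<in> ?T} = {y, z}"
    "{v. (y, v) \<in> ?T} = {x, z}" "{v. (v, y) \<in> ?T} = {x, z}"
    "{v. (z, v) \<in> ?T} = {x, y}" "{v. (v, z) \<in> ?T} = {x, y}"
    using assms by auto
  then show ?thesis using assms by (simp add: regular_arcs_def)
qed

lemma regular_arcs_empty: "regular_arcs V 0 {}"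
  by (simp add: regular_arcs_def)

lemma finite_nonadj_pairs: "finite V \<Longrightarrow> finite (nonadj_pairs G V)"
  by (rule finite_subset[of _ "V \<times> V"]) (auto simp: nonadj_pairs_def)

lemma nonadj_pairs_mono: "V \<subseteq> W \<Longrightarrow> nonadj_pairs G V \<subseteq> nonadj_pairs G W"
  by (auto simp: nonadj_pairs_def)

text \<open>If every other vertex has a neighbour outside \<open>{x, y}\<close>, a matching of the
  rest together with both arcs of the edge is a 1-regular start to be extended. Otherwise some
  \<open>z\<close> has no neighbours but \<open>x\<close> and \<open>y\<close>, which forces
  \<open>a = 2\<close>.\<close>

lemma exists_regular_arcs_through_edge:
  assumes G: "simple_graph G" and a: "2 \<le> a" "4 * a + 8 \<le> card (verts G)"
    and C: "card (nonadj_pairs G (verts G)) \<le> 2 * (card (verts G) - 2)"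
    and deg: "\<And>v. v \<in> verts G \<Longrightarrow> a \<le> card (neighbours G v)"
    and e: "{x, y} \<in> edges G"
  shows "\<exists>M. regular_arcs (verts G) a M \<and> (\<forall>(u, v)\<in>M. {u, v} \<in> edges G)
    \<and> (x, y) \<in> M \<and> (y, x) \<in> M"
proof -
  let ?V = "verts G"
  have fin: "finite ?V" using G by (simp add: simple_graph_def)
  have xy: "x \<in> ?V" "y \<in> ?V" "x \<noteq> y"
    using G e by (auto simp: simple_graph_def)
  show ?thesis
  proof (cases "\<forall>z\<in>?V - {x, y}. \<exists>v\<in>?V - {x, y}. {z, v} \<in> edges G")
    case True
    let ?W = "?V - {x, y}"
    have cW: "card ?W = card ?V - 2"
      using xy by (simp add: card_Diff_subset)
    \<comment> \<open>The bound on missing pairs is twice \<open>card ?W\<close>, just what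
      \<open>exists_matching\<close> allows after the loss of two vertices.\<close>
    have "card (nonadj_pairs G ?W) \<le> card (nonadj_pairs G ?V)"
      by (intro card_mono finite_nonadj_pairs fin nonadj_pairs_mono) auto
    then have "\<exists>M'. regular_arcs ?W 1 M' \<and> M' \<inter> {} = {} \<and> (\<forall>(u, v)\<in>M'. {u, v} \<in> edges G)"
      using fin True a C cW
      by (intro exists_matching[of ?W 0] regular_arcs_empty) (auto simp: insert_commute)
    then obtain M' where M': "regular_arcs ?W 1 M'" "\<forall>(u, v)\<in>M'. {u, v} \<in> edges G" by blast
    let ?M = "{(x, y), (y, x)} \<union> M'"
    have "{x, y} \<union> ?W = ?V" using xy by auto
    then have "regular_arcs ?V 1 ?M"
      using regular_arcs_Un_disjoint[OF regular_arcs_edge[OF xy(3)] M'(1)] by simp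
    moreover have "{u, v} \<in> edges G" if "(u, v) \<in> ?M" for u v
      using that M'(2) e by (auto simp: insert_commute)
    moreover have "{v \<in> ?V. {u, v} \<in> edges G} = neighbours G u" for u
      by (simp add: neighbours_def)
    ultimately have "\<exists>M. regular_arcs ?V a M \<and> ?M \<subseteq> M \<and> (\<forall>(u, v)\<in>M. {u, v} \<in> edges G)"
      using a C deg by (intro extend_regular_arcs[OF fin, of _ _ 1]) auto
    then show ?thesis by auto
  next
    case False
    then obtain z where z: "z \<in> ?V" "z \<noteq> x" "z \<noteq> y" "\<And>v. v \<in> ?V - {x, y} \<Longrightarrow> {z, v} \<notin> edges G"
      by auto
    then have Nz: "neighbours G z \<subseteq> {x, y}" by (auto simp: neighbours_def)
    have "card {x, y} \<le> card (neighbours G z)"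
      using a deg[OF z(1)] xy(3) by simp
    then have Nz': "neighbours G z = {x, y}" using Nz by (intro card_seteq) auto
    then have a2: "a = 2" using a deg[OF z(1)] xy(3) by simp
    \<comment> \<open>A perfect matching with the arcs \<open>(x, y)\<close> and \<open>(y, x)\<close> leaves no partner for
      \<open>z\<close>; instead, the triangle \<open>xyz\<close> is split off.\<close>
    let ?W = "?V - {x, y, z}" and ?T = "{(x, y), (y, x), (x, z), (z, x), (y, z), (z, y)}"
    have cW: "card ?W = card ?V - 3"
      using xy z by (subst card_Diff_subset) auto
    have finW: "finite ?W" using fin by simp
    \<comment> \<open>The vertex \<open>z\<close> alone accounts for
      \<open>2 * (card ?V - 3)\<close> of the at most \<open>2 * (card ?V - 2)\<close> nonadjacent
      pairs, so at most two pairs remain inside \<open>?W\<close>.\<close>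
    have "nonadj_pairs G ?W \<union> ({z} \<times> ?W \<union> ?W \<times> {z}) \<subseteq> nonadj_pairs G ?V"
      using z by (auto simp: nonadj_pairs_def insert_commute)
    then have "card (nonadj_pairs G ?W \<union> ({z} \<times> ?W \<union> ?W \<times> {z})) \<le> card (nonadj_pairs G ?V)"
      by (intro card_mono finite_nonadj_pairs fin)
    also have "card (nonadj_pairs G ?W \<union> ({z} \<times> ?W \<union> ?W \<times> {z}))
        = card (nonadj_pairs G ?W) + card ({z} \<times> ?W \<union> ?W \<times> {z})"
      using finW finite_nonadj_pairs[OF finW] by (intro card_Un_disjoint) (auto simp: nonadj_pairs_def)
    also have "card ({z} \<times> ?W \<union> ?W \<times> {z}) = card ({z} \<times> ?W) + card (?W \<times> {z})"
      using finW by (intro card_Un_disjoint) auto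
    finally have CW: "card (nonadj_pairs G ?W) \<le> 2"
      using C cW a by (simp add: card_cartesian_product)
    have "2 \<le> card {v \<in> ?W. {u, v} \<in> edges G}" if u: "u \<in> ?W" for u
    proof -
      let ?A = "{v \<in> ?W. {u, v} \<in> edges G}"
      have "?W \<subseteq> insert u (?A \<union> snd ` nonadj_pairs G ?W)"
        using u by (force simp: nonadj_pairs_def image_iff)
      then have "card ?W \<le> card (insert u (?A \<union> snd ` nonadj_pairs G ?W))"
        using finW finite_nonadj_pairs[OF finW] by (intro card_mono) auto
      also have "\<dots> \<le> Suc (card (?A \<union> snd ` nonadj_pairs G ?W))"
        by (rule card_insert_le_m1) auto
      also have "card (?A \<union> snd ` nonadj_pairs G ?W) \<le> card ?A + card (snd ` nonadj_pairs G ?W)"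
        by (rule card_Un_le)
      also have "card (snd ` nonadj_pairs G ?W) \<le> card (nonadj_pairs G ?W)"
        by (intro card_image_le finite_nonadj_pairs finW)
      finally show ?thesis using CW cW a by simp
    qed
    \<comment> \<open>Starting from the empty arc set needs 13 vertices in \<open>?W\<close>; with
      \<open>a = 2\<close>, the assumed \<open>4 * a + 8\<close> vertices less the triangle suffice
      exactly.\<close>
    then have "\<exists>M'. regular_arcs ?W 2 M' \<and> {} \<subseteq> M' \<and> (\<forall>(u, v)\<in>M'. {u, v} \<in> edges G)"
      using a cW CW by (intro extend_regular_arcs[OF finW, of 2 G 0] regular_arcs_empty) auto
    then obtain M' where M': "regular_arcs ?W 2 M'" "\<forall>(u, v)\<in>M'. {u, v} \<in> edges G" by blast
    have "{x, y, z} \<union> ?W = ?V" using xy z by auto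
    then have "regular_arcs ?V a (?T \<union> M')"
      using regular_arcs_Un_disjoint[OF regular_arcs_triangle M'(1), of x y z] xy z a2 by auto
    moreover have "{x, z} \<in> edges G" "{y, z} \<in> edges G"
      using Nz' by (auto simp: neighbours_def insert_commute)
    then have "\<forall>(u, v)\<in>?T \<union> M'. {u, v} \<in> edges G"
      using M'(2) e by (auto simp: insert_commute)
    ultimately show ?thesis by blast
  qed
qed

section \<open>Counting missing edges and the conclusion\<close>

lemma card_nonadj_pairs:
  assumes G: "simple_graph G"
  shows "(\<Sum>v\<in>verts G. card (neighbours G v)) + card (nonadj_pairs G (verts G))
    = card (verts G) * (card (verts G) - 1)"
proof -
  let ?V = "verts G"
  have fin: "finite ?V" using G by (simp add: simple_graph_def)
  have "nonadj_pairs G ?V = Sigma ?V (\<lambda>u. ?V - insert u (neighbours G u))"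
    by (auto simp: nonadj_pairs_def neighbours_def)
  then have "card (nonadj_pairs G ?V) = (\<Sum>u\<in>?V. card (?V - insert u (neighbours G u)))"
    using fin by (simp add: card_SigmaI)
  then have "(\<Sum>v\<in>?V. card (neighbours G v)) + card (nonadj_pairs G ?V)
      = (\<Sum>u\<in>?V. card (neighbours G u) + card (?V - insert u (neighbours G u)))"
    by (simp add: sum.distrib)
  also have "\<dots> = (\<Sum>u\<in>?V. card ?V - 1)"
  proof (intro sum.cong refl)
    fix u assume u: "u \<in> ?V"
    have sub: "insert u (neighbours G u) \<subseteq> ?V" using u neighbours_subset by fast
    have "card (insert u (neighbours G u)) = Suc (card (neighbours G u))"
      using finite_neighbours[OF G] neighbours_irrefl[OF G] by (intro card_insert_disjoint)
    moreover have "card (?V - insert u (neighbours G u)) = card ?V - card (insert u (neighbours G u))"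
      by (intro card_Diff_subset finite_subset[OF sub fin] sub)
    ultimately show "card (neighbours G u) + card (?V - insert u (neighbours G u)) = card ?V - 1"
      using card_mono[OF fin sub] by simp
  qed
  finally show ?thesis by simp
qed

theorem theorem1p4:
  fixes G :: "'v graph" and a b n :: nat
  assumes "2 \<le> a" and "a \<le> b"
    and "simple_graph G" and "card (verts G) = n"
    and "real n \<ge> 2 + sqrt (32 * real a ^ 2 + 24 * real a + 5)"
    and "graph_spectral_radius G \<ge> graph_spectral_radius (H_graph n a)"
    and "\<not> graph_iso G (H_graph n a)"
  shows "fractional_covered a b G"
proof -
  let ?V = "verts G"
  have fin: "finite ?V" using assms(3) by (simp add: simple_graph_def)
  \<comment> \<open>For \<open>a \<ge> 2\<close> the radicand exceeds
    \<open>(4 * a + 5)\<^sup>2\<close>, so \<open>n > 4 * a + 7\<close>, and integrality gives the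
    rest.\<close>
  have n: "4 * a + 8 \<le> n"
  proof -
    have "2 * real a \<le> real a * real a" using assms(1) by (intro mult_right_mono) auto
    moreover have "2 \<le> real a" using assms(1) by simp
    moreover have "(4 * real a + 5)\<^sup>2 = 16 * (real a * real a) + 40 * real a + 25"
      by (simp add: power2_eq_square algebra_simps)
    ultimately have "(4 * real a + 5)\<^sup>2 < 32 * real a ^ 2 + 24 * real a + 5"
      unfolding power2_eq_square[of "real a"] by linarith
    then have "4 * real a + 5 < sqrt (32 * real a ^ 2 + 24 * real a + 5)"
      by (rule real_less_rsqrt)
    then show ?thesis using assms(5) by linarith
  qed
  have deg: "a \<le> card (neighbours G v)" if "v \<in> ?V" for v
  proof -
    have "a < n" using n by simp
    from graph_iso_H_graph_of_low_degree[OF assms(3,4,1) this assms(6) that] assms(7)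
    show ?thesis by linarith
  qed
  obtain \<theta> where \<theta>: "real n - 2 < \<theta>" "\<theta> \<le> graph_spectral_radius (H_graph n a)"
    by (rule H_graph_spectral_radius_ge[OF assms(1), of n]) (use n in auto)
  have "?V \<noteq> {}" using assms(4) n by auto
  then have "(graph_spectral_radius G)\<^sup>2
      \<le> (\<Sum>v\<in>?V. real (card (neighbours G v))) - (real (card ?V) - 1)"
    using deg assms(1)
    by (intro adj_eigenvalue_square_le assms(3) adj_eigenvalue_spectral_radius fin) fastforce
  moreover have "(real n - 2)\<^sup>2 < (graph_spectral_radius G)\<^sup>2"
    using \<theta> assms(6) n by (intro power_strict_mono) auto
  moreover have "(\<Sum>v\<in>?V. real (card (neighbours G v))) + real (card (nonadj_pairs G ?V))
      = real n * (real n - 1)"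
    using arg_cong[OF card_nonadj_pairs[OF assms(3)], of real] assms(4) n
    by (simp add: of_nat_diff)
  \<comment> \<open>Hong's bound reads \<open>(n - 2)\<^sup>2 < n * (n - 1) - c - (n - 1)\<close>
    for the number \<open>c\<close> of nonadjacent ordered pairs, that is,
    \<open>c < 2 * n - 3\<close>; integrality then gives \<open>2 * (n - 2)\<close>.\<close>
  ultimately have "real (card (nonadj_pairs G ?V)) < 2 * real n - 3"
    using assms(4) by (simp add: power2_eq_square algebra_simps)
  then have C: "card (nonadj_pairs G ?V) \<le> 2 * (card ?V - 2)"
    using assms(4) n by linarith
  show ?thesis
    unfolding fractional_covered_def
  proof
    fix e assume e: "e \<in> edges G"
    then obtain x y where xy: "e = {x, y}" "x \<noteq> y"
      using assms(3) by (auto simp: simple_graph_def card_2_iff)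
    have "\<exists>M. regular_arcs ?V a M \<and> (\<forall>(u, v)\<in>M. {u, v} \<in> edges G) \<and> (x, y) \<in> M \<and> (y, x) \<in> M"
      using e n xy(1) assms(4)
      by (intro exists_regular_arcs_through_edge[OF assms(3,1) _ C deg]) auto
    then obtain M where
      "regular_arcs ?V a M" "\<forall>(u, v)\<in>M. {u, v} \<in> edges G" "(x, y) \<in> M" "(y, x) \<in> M"
      by blast
    then show "\<exists>h F. fractional_factor a b G h F \<and> h e = 1"
      unfolding xy(1) using assms(2,3) xy(2)
      by (intro fractional_factor_of_regular_arcs[of G a b M]) auto
  qed
qed

end
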